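(* Let $X \subset S^{\mathbb{Z}}$ be a countable subshift with $\mathrm{Q}(X) \leq 3$. Then $X = \overline{\mathcal{O}({}^\infty u\, v\, u^\infty)}$ for some words $u, v$, and thus $X$ is decidable.
   Context: $S$ is a finite alphabet. A subshift is a closed (product topology) set $X \subset S^{\mathbb{Z}}$ with $\sigma(X)=X$, where $\sigma(x)_i=x_{i+1}$. $\mathrm{Q}(X)$ denotes the number of subshifts $Y \subset X$, counting both $\emptyset$ and $X$ itself. For finite words $u, v$ over $S$, ${}^\infty u\, v\, u^\infty$ is the bi-infinite point consisting of $v$ preceded by infinitely many repetitions of $u$ and followed by infinitely many repetitions of $u$ (its position relative to the origin is irrelevant), and $\overline{\mathcal{O}(x)}$ is the closure of the orbit $\{\sigma^i(x) : i \in \mathbb{Z}\}$. $X$ is decidable if its model-checking problem for Muller automata is decidable: given a language $Y \subset S^{\mathbb{Z}}$ of infinite words described by a Muller automaton (a finite automaton reading infinite words, accepting according to whether the set of states visited infinitely often belongs to a prescribed family of sets of states), decide whether $X \cap Y \neq \emptyset$.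
   Formalization: The claim that X is the orbit closure of a point with words u, v is made only for nonempty X, since the empty subshift has Q = 1 but an orbit closure is never empty; u is nonempty, and decidability is still claimed for every X. *)

theory Defs
  imports "HOL-Analysis.Analysis" "HOL-Library.Nat_Bijection" "HOL-Library.Extended_Nat"
    "HOL-Library.Countable"
begin

definition full_shift_topology :: "(int \<Rightarrow> 'a) topology" where
  "full_shift_topology = product_topology (\<lambda>_. discrete_topology UNIV) UNIV"

definition shift :: "(int \<Rightarrow> 'a) \<Rightarrow> (int \<Rightarrow> 'a)" where
  "shift x = (\<lambda>i. x (i + 1))"

definition subshift :: "(int \<Rightarrow> 'a) set \<Rightarrow> bool" where
  "subshift X \<longleftrightarrow> closedin full_shift_topology X \<and> shift ` X = X"

text \<open>Extended naturals are used because \<^const>\<open>card\<close> is 0 on infinite sets.\<close>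

definition num_subshifts :: "(int \<Rightarrow> 'a) set \<Rightarrow> enat" where
  "num_subshifts X =
    (if finite {Y. subshift Y \<and> Y \<subseteq> X} then enat (card {Y. subshift Y \<and> Y \<subseteq> X}) else \<infinity>)"

definition orbit :: "(int \<Rightarrow> 'a) \<Rightarrow> (int \<Rightarrow> 'a) set" where
  "orbit x = {y. \<exists>k. y = (\<lambda>i. x (i + k))}"

definition orbit_closure :: "(int \<Rightarrow> 'a) \<Rightarrow> (int \<Rightarrow> 'a) set" where
  "orbit_closure x = full_shift_topology closure_of (orbit x)"

text \<open>The point with \<open>v\<close> at positions \<open>0, \<dots>, |v| - 1\<close>, copies of \<open>u\<close> ending at position \<open>-1\<close>
  to the left and copies of \<open>u\<close> starting at position \<open>|v|\<close> to the right. It is only meaningful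
  for nonempty \<open>u\<close>.\<close>

definition two_sided_point :: "'a list \<Rightarrow> 'a list \<Rightarrow> int \<Rightarrow> 'a" where
  "two_sided_point u v i =
    (if i < 0 then u ! nat (i mod int (length u))
     else if i < int (length v) then v ! nat i
     else u ! nat ((i - int (length v)) mod int (length u)))"

record 'a muller =
  states :: "nat set"
  transitions :: "(nat \<times> 'a \<times> nat) set"
  acceptance :: "nat set set"

definition muller_automaton :: "'a muller \<Rightarrow> bool" where
  "muller_automaton A \<longleftrightarrow> finite (states A) \<and>
    transitions A \<subseteq> states A \<times> UNIV \<times> states A \<and> acceptance A \<subseteq> Pow (states A)"

text \<open>Runs are indexed by all of \<open>\<int>\<close>, so no initial state is involved.
  The automata are nondeterministic. One-sided acceptance
  from an initial state reduces to this notion on shift-invariant sets, by adding a fresh state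
  that loops on every letter and in which a run stays on the left half-line; acceptance
  conditions on the pair of sets visited infinitely often to the left and to the right reduce
  to it by using two disjoint copies of the states.\<close>

definition run :: "'a muller \<Rightarrow> (int \<Rightarrow> 'a) \<Rightarrow> (int \<Rightarrow> nat) \<Rightarrow> bool" where
  "run A x r \<longleftrightarrow> (\<forall>i. (r i, x i, r (i + 1)) \<in> transitions A)"

definition muller_language :: "'a muller \<Rightarrow> (int \<Rightarrow> 'a) set" where
  "muller_language A = {x. \<exists>r. run A x r \<and> {q. infinite {i. r i = q}} \<in> acceptance A}"

text \<open>The function \<^const>\<open>to_nat\<close> is a fixed injection of the finite alphabet into \<open>\<nat>\<close>; its
  choice does not affect decidability.\<close>

definition transition_code :: "nat \<times> 'a::countable \<times> nat \<Rightarrow> nat" where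
  "transition_code = (\<lambda>(p, a, q). prod_encode (p, prod_encode (to_nat a, q)))"

definition muller_code :: "'a::countable muller \<Rightarrow> nat" where
  "muller_code A = prod_encode (set_encode (states A),
    prod_encode (set_encode (transition_code ` transitions A),
      set_encode (set_encode ` acceptance A)))"

lemma inj_transition_code: "inj transition_code"
  by (auto simp: inj_def transition_code_def)

lemma finite_muller_automaton:
  fixes A :: "'a::finite muller"
  assumes "muller_automaton A"
  shows "finite (states A)" "finite (transitions A)" "finite (acceptance A)"
    "\<And>F. F \<in> acceptance A \<Longrightarrow> finite F"
proof -
  show *: "finite (states A)"
    using assms by (simp add: muller_automaton_def)
  have "finite (states A \<times> (UNIV :: 'a set) \<times> states A)"
    using * by simp
  then show "finite (transitions A)"
    using assms by (auto simp: muller_automaton_def intro: finite_subset)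
  show "finite (acceptance A)"
    using assms * by (simp add: muller_automaton_def finite_subset[where B = "Pow (states A)"])
  show "finite F" if "F \<in> acceptance A" for F
    using assms that by (auto simp: muller_automaton_def intro: finite_subset[where B = "states A"])
qed

lemma muller_code_inject:
  fixes A B :: "'a::finite muller"
  assumes A: "muller_automaton A" and B: "muller_automaton B"
    and eq: "muller_code A = muller_code B"
  shows "A = B"
proof -
  note fin = finite_muller_automaton[OF A] finite_muller_automaton[OF B]
  have se: "S = T" if "set_encode S = set_encode T" "finite S" "finite T" for S T
    using that by (metis set_encode_inverse)
  have "set_encode (states A) = set_encode (states B)"
    and t: "set_encode (transition_code ` transitions A) = set_encode (transition_code ` transitions B)"
    and f: "set_encode (set_encode ` acceptance A) = set_encode (set_encode ` acceptance B)"
    using eq by (simp_all add: muller_code_def)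
  then have s: "states A = states B"
    using se fin by blast
  have "transition_code ` transitions A = transition_code ` transitions B"
    using se t fin by blast
  then have t': "transitions A = transitions B"
    using inj_transition_code by (metis inj_image_eq_iff)
  have "set_encode ` acceptance A = set_encode ` acceptance B"
    using se f fin by blast
  moreover have "inj_on set_encode (acceptance A \<union> acceptance B)"
    by (rule inj_onI) (use se fin in blast)
  ultimately have "acceptance A = acceptance B"
    by (metis inj_on_image_eq_iff Un_upper1 Un_upper2)
  with s t' show ?thesis by simp
qed

datatype recf = Zero | Succ | Proj nat | Comp recf "recf list" | PrimRec recf recf | Mu recf

text \<open>\<open>eval p xs y\<close> means that the partial recursive function \<open>p\<close> is defined on \<open>xs\<close>
  with value \<open>y\<close>.\<close>

inductive eval :: "recf \<Rightarrow> nat list \<Rightarrow> nat \<Rightarrow> bool" where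
  zero: "eval Zero xs 0"
| succ: "eval Succ [x] (Suc x)"
| proj: "i < length xs \<Longrightarrow> eval (Proj i) xs (xs ! i)"
| comp: "list_all2 (\<lambda>g y. eval g xs y) gs ys \<Longrightarrow> eval f ys z \<Longrightarrow> eval (Comp f gs) xs z"
| primrec_0: "eval f xs y \<Longrightarrow> eval (PrimRec f g) (0 # xs) y"
| primrec_Suc: "eval (PrimRec f g) (n # xs) y \<Longrightarrow> eval g (n # y # xs) z \<Longrightarrow>
    eval (PrimRec f g) (Suc n # xs) z"
| mu: "eval f (n # xs) 0 \<Longrightarrow> (\<forall>m<n. \<exists>y. eval f (m # xs) (Suc y)) \<Longrightarrow> eval (Mu f) xs n"

inductive_cases zeroE: "eval Zero xs y"
inductive_cases succE: "eval Succ xs y"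
inductive_cases projE: "eval (Proj i) xs y"
inductive_cases compE: "eval (Comp f gs) xs y"
inductive_cases primrec_0E: "eval (PrimRec f g) (0 # xs) y"
inductive_cases primrec_SucE: "eval (PrimRec f g) (Suc n # xs) y"
inductive_cases muE: "eval (Mu f) xs y"

lemma eval_deterministic: "eval p xs y \<Longrightarrow> eval p xs z \<Longrightarrow> y = z"
proof (induction arbitrary: z rule: eval.induct)
  case (zero xs)
  then show ?case by (rule zeroE) simp
next
  case (succ x)
  then show ?case by (rule succE) simp
next
  case (proj i xs)
  from proj(2) show ?case by (rule projE) simp
next
  case (comp xs gs ys f y z)
  from comp.prems obtain ys' where ys': "list_all2 (\<lambda>g y. eval g xs y) gs ys'" "eval f ys' z"
    by (rule compE)
  have "ys = ys'"
    using comp.IH(1) ys'(1) by (auto simp: list_all2_conv_all_nth intro!: nth_equalityI)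
  with comp.IH(2) ys'(2) show ?case by blast
next
  case (primrec_0 f xs y g)
  from primrec_0.prems have "eval f xs z" by (rule primrec_0E)
  with primrec_0.IH show ?case by blast
next
  case (primrec_Suc f g n xs y w z)
  from primrec_Suc.prems obtain y' where "eval (PrimRec f g) (n # xs) y'" "eval g (n # y' # xs) z"
    by (rule primrec_SucE)
  with primrec_Suc.IH show ?case by blast
next
  case (mu f n xs z)
  from mu.prems have z: "eval f (z # xs) 0" "\<forall>m<z. \<exists>y. eval f (m # xs) (Suc y)"
    by (rule muE, simp)+
  have "\<not> n < z" using z(2) mu.IH(1) by (metis nat.distinct(1))
  moreover have "\<not> z < n" using z(1) mu.IH(2) by (metis nat.distinct(2))
  ultimately show ?case by simp
qed

definition decidable_subshift :: "(int \<Rightarrow> 'a::finite) set \<Rightarrow> bool" where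
  "decidable_subshift X \<longleftrightarrow> (\<exists>p. \<forall>A :: 'a muller. muller_automaton A \<longrightarrow>
    eval p [muller_code A] (if X \<inter> muller_language A \<noteq> {} then 1 else 0))"

end

theory Submission
  imports Defs
begin

text \<open>
  A nonempty countable compact Hausdorff space has isolated points, and a dense orbit contains every
  isolated point. In a minimal countable subshift all orbits are dense, so it is a single orbit of
  isolated points; being compact it is finite, that is, a periodic orbit (\<open>minimal_countable_subshift\<close>).
  This is the case of an empty \<open>v\<close>. If \<open>X\<close> has exactly three subshifts, the one strictly between
  \<open>{}\<close> and \<open>X\<close> is such a periodic orbit \<open>M\<close>, and each point outside \<open>M\<close> has an orbit that is dense
  in \<open>X\<close>. An isolated point \<open>y\<close> of \<open>X\<close> lies outside \<open>M\<close>, since otherwise \<open>X - M\<close> would be closed; so \<open>X\<close> is the union of \<open>M\<close> and the orbit of \<open>y\<close>. By compactness all but finitely many translates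
  of \<open>y\<close> look like a point of \<open>M\<close> on a window longer than the period of \<open>M\<close>, which forces \<open>y\<close> to be
  periodic on both sides, where the two repeated words are rotations of each other
  (\<open>countable_subshift_two_sided_point\<close>).

  For decidability, such an \<open>X\<close> is recognised as a sofic shift: its points are the labels of the
  bi-infinite paths in a graph made of two cycles labelled \<open>u\<close>, joined by a segment labelled \<open>v\<close>
  (\<open>path_labels_lasso\<close>). Every sofic shift is decidable (\<open>decidable_path_labels\<close>). An accepting run on
  a point of the shift is a bi-infinite path in the product of the graph and the automaton. The sets of
  vertices visited infinitely often by bi-infinite paths in a finite graph are the unions \<open>V1 \<union> V2\<close>
  of two strongly connected sets such that \<open>V2\<close> can be reached from \<open>V1\<close> (\<open>bi_infinite_path_iff\<close>).
  So the question becomes whether a finite graph contains two such sets whose union projects to an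
  accepting set of states. Reachability is expressed by quantifying over sets of vertices closed under
  edges; with finite sets coded as numbers, the whole criterion is a formula with bounded quantifiers
  over addition, multiplication and exponentiation, and such formulas define recursive predicates.
\<close>

section \<open>Countable subshifts with at most three subshifts\<close>

lemma topspace_full_shift [simp]: "topspace full_shift_topology = UNIV"
  by (auto simp: full_shift_topology_def PiE_def extensional_def)

lemma compact_full_shift: "compact_space (full_shift_topology :: (int \<Rightarrow> 'a::finite) topology)"
  unfolding full_shift_topology_def
  by (simp add: compact_space_product_topology compact_space_discrete_topology)

lemma Hausdorff_full_shift: "Hausdorff_space full_shift_topology"
  unfolding full_shift_topology_def
  by (simp add: Hausdorff_space_product_topology)

lemma openin_coordinate: "openin full_shift_topology {x. x i = a}"
proof -
  have "openin full_shift_topology {x \<in> topspace full_shift_topology. x i \<in> {a}}"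
    unfolding full_shift_topology_def
    by (rule openin_continuous_map_preimage[OF continuous_map_product_projection]) auto
  then show ?thesis by simp
qed

text \<open>All powers of the shift, negative ones included. Working with the whole \<open>\<int>\<close>-action
  makes orbits of points into orbits of a group action, so that they partition every subshift.\<close>

definition translate :: "int \<Rightarrow> (int \<Rightarrow> 'a) \<Rightarrow> int \<Rightarrow> 'a" where
  "translate k x = (\<lambda>i. x (i + k))"

lemma translate_translate [simp]: "translate k (translate l x) = translate (k + l) x"
  by (simp add: translate_def add_ac)

lemma translate_0 [simp]: "translate 0 x = x"
  by (simp add: translate_def)

lemma shift_eq_translate: "shift = translate 1"
  by (simp add: fun_eq_iff shift_def translate_def)

lemma inj_translate: "inj (translate k)"
  by (rule inj_on_inverseI[where g = "translate (- k)"]) simp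

lemma orbit_eq: "orbit x = range (\<lambda>k. translate k x)"
  by (auto simp: orbit_def translate_def)

lemma orbit_translate [simp]: "orbit (translate k x) = orbit x"
proof -
  have "translate l x = translate (l - k) (translate k x)" for l by simp
  then show ?thesis unfolding orbit_eq by (auto simp: image_iff) (metis diff_add_cancel)
qed

lemma orbit_eqI: "y \<in> orbit x \<Longrightarrow> orbit y = orbit x"
  by (auto simp: orbit_eq[of x])

lemma self_in_orbit [simp]: "x \<in> orbit x"
  unfolding orbit_eq by (rule range_eqI[of _ _ 0]) simp

lemma homeomorphic_map_translate:
  "homeomorphic_map full_shift_topology full_shift_topology (translate k :: (int \<Rightarrow> 'a) \<Rightarrow> _)"
proof -
  have "continuous_map full_shift_topology full_shift_topology (translate k :: (int \<Rightarrow> 'a) \<Rightarrow> _)" for k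
    unfolding full_shift_topology_def translate_def
    by (auto simp: continuous_map_componentwise_UNIV intro: continuous_map_product_projection)
  then have "homeomorphic_maps full_shift_topology full_shift_topology (translate k :: (int \<Rightarrow> 'a) \<Rightarrow> _) (translate (- k))"
    by (simp add: homeomorphic_maps_def)
  then show ?thesis by (auto simp: homeomorphic_map_maps)
qed

lemma subshift_iff:
  fixes X :: "(int \<Rightarrow> 'a) set"
  shows "subshift X \<longleftrightarrow> closedin full_shift_topology X \<and> (\<forall>k. translate k ` X = X)"
proof
  assume "closedin full_shift_topology X \<and> (\<forall>k. translate k ` X = X)"
  then show "subshift X" by (simp add: subshift_def shift_eq_translate)
next
  assume X: "subshift X"
  have 1: "translate 1 ` X = X"
    using X by (simp add: subshift_def shift_eq_translate)
  have inverse: "translate (- 1) ` X = X"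
  proof -
    have "translate (- 1) ` X = translate (- 1) ` translate 1 ` X" by (simp only: 1)
    also have "\<dots> = X" by (simp add: image_image)
    finally show ?thesis .
  qed
  have "translate k ` X = X" for k
  proof (induction k rule: int_induct[where k = 0])
    case (step1 i)
    have "translate (i + 1) ` X = translate i ` translate 1 ` X" by (simp add: image_image)
    then show ?case using 1 step1 by simp
  next
    case (step2 i)
    have "translate (i - 1) ` X = translate i ` translate (- 1) ` X" by (simp add: image_image)
    then show ?case using inverse step2 by simp
  qed simp
  then show "closedin full_shift_topology X \<and> (\<forall>k. translate k ` X = X)"
    using X by (simp add: subshift_def)
qed

lemma translate_in_subshift: "subshift X \<Longrightarrow> x \<in> X \<Longrightarrow> translate k x \<in> X"
  unfolding subshift_iff by blast

lemma orbit_subset_subshift: "subshift X \<Longrightarrow> x \<in> X \<Longrightarrow> orbit x \<subseteq> X"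
  using translate_in_subshift by (auto simp: orbit_eq)

lemma subshift_orbit_closure: "subshift (orbit_closure x)"
proof -
  have "translate k ` orbit x = orbit x" for k
  proof -
    have "translate l x = translate k (translate (l - k) x)" for l by simp
    then show ?thesis unfolding orbit_eq by (auto simp: image_iff) (metis add.commute diff_add_cancel)
  qed
  then have "translate k ` orbit_closure x = orbit_closure x" for k
    unfolding orbit_closure_def
    using homeomorphic_map_closure_of[OF homeomorphic_map_translate, of "orbit x" k] by simp
  then show ?thesis by (simp add: subshift_iff orbit_closure_def)
qed

lemma orbit_subset_orbit_closure: "orbit x \<subseteq> orbit_closure x"
  unfolding orbit_closure_def by (rule closure_of_subset) simp

lemma orbit_closure_subset_subshift: "subshift X \<Longrightarrow> x \<in> X \<Longrightarrow> orbit_closure x \<subseteq> X"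
  unfolding orbit_closure_def
  by (intro closure_of_minimal orbit_subset_subshift) (auto simp: subshift_iff)

text \<open>A nonempty closed set without isolated points is perfect, and a nonempty perfect set in a compact Hausdorff space has at least the cardinality of the continuum.\<close>

lemma countable_subshift_isolated_point:
  fixes X :: "(int \<Rightarrow> 'a::finite) set"
  assumes "subshift X" "countable X" "X \<noteq> {}"
  obtains x where "x \<in> X" "x \<notin> full_shift_topology derived_set_of X"
proof -
  have "\<not> X \<subseteq> full_shift_topology derived_set_of X"
  proof
    assume "X \<subseteq> full_shift_topology derived_set_of X"
    moreover have "full_shift_topology derived_set_of X \<subseteq> X"
      using assms(1) by (simp add: subshift_iff closedin_contains_derived_set)
    ultimately have "full_shift_topology derived_set_of X = X" by blast
    then have "(UNIV :: real set) \<lesssim> X"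
      using assms(3) compact_full_shift Hausdorff_full_shift
      by (intro lepoll_perfect_set) (auto intro: compact_imp_locally_compact_space)
    then show False
      using countable_lepoll[OF assms(2)] uncountable_UNIV_real by blast
  qed
  then show ?thesis using that by blast
qed

lemma isolated_translate:
  assumes "subshift X" "x \<notin> full_shift_topology derived_set_of X"
  shows "translate k x \<notin> full_shift_topology derived_set_of X"
proof -
  have "full_shift_topology derived_set_of X = translate k ` (full_shift_topology derived_set_of X)"
    using homeomorphic_map_derived_set_of[OF homeomorphic_map_translate, of X k] assms(1)
    by (simp add: subshift_iff)
  then show ?thesis using assms(2) inj_translate[of k] by (metis inj_image_mem_iff)
qed

text \<open>An orbit that accumulates at an isolated point must meet every neighbourhood of it, in particular
  one that contains no other point of \<open>X\<close>; hence it passes through the point itself.\<close>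

lemma orbit_of_isolated_point:
  assumes X: "subshift X" and x: "x \<notin> full_shift_topology derived_set_of X" "x \<in> X"
    and z: "z \<in> X" "x \<in> orbit_closure z"
  shows "z \<in> orbit x"
proof -
  obtain U where U: "openin full_shift_topology U" "x \<in> U" "\<And>y. y \<in> X \<Longrightarrow> y \<in> U \<Longrightarrow> y = x"
    using x(1) by (auto simp: in_derived_set_of)
  then obtain y where "y \<in> orbit z" "y \<in> U"
    using z(2) unfolding orbit_closure_def in_closure_of by blast
  then have "x \<in> orbit z" using U(3) orbit_subset_subshift[OF X z(1)] by blast
  then show ?thesis using orbit_eqI[of x z] by simp
qed

lemma finite_closed_isolated:
  fixes S :: "(int \<Rightarrow> 'a::finite) set"
  assumes "closedin full_shift_topology S" "S \<inter> full_shift_topology derived_set_of S = {}"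
  shows "finite S"
  using discrete_compactin_eq_finite[OF assms(2)] closedin_compact_space[OF compact_full_shift assms(1)]
  by simp

lemma finite_orbit_periodic:
  assumes "finite (orbit x)"
  obtains n :: nat where "n > 0" "\<And>i. x (i + int n) = x i"
proof -
  have "\<not> inj (\<lambda>k::nat. translate (int k) x)"
    using assms finite_subset[of "range (\<lambda>k::nat. translate (int k) x)" "orbit x"]
      range_inj_infinite[of "\<lambda>k::nat. translate (int k) x"]
    by (auto simp: orbit_eq)
  then obtain k l :: nat where kl: "k < l" "translate (int k) x = translate (int l) x"
    unfolding inj_def by (metis linorder_neqE_nat)
  have "x (i + int (l - k)) = x i" for i
    using fun_cong[OF kl(2), of "i - int k"] kl(1) by (simp add: translate_def of_nat_diff algebra_simps)
  then show ?thesis using that[of "l - k"] kl(1) by simp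
qed

lemma periodic_cong:
  assumes per: "\<And>i. x (i + int n) = x i" and "i mod int n = j mod int n"
  shows "x i = x j"
proof -
  have *: "x (i + int n * k) = x i" for i k
  proof (induction k rule: int_induct[where k = 0])
    case (step1 k)
    then show ?case using per[of "i + int n * k"] by (simp add: algebra_simps)
  next
    case (step2 k)
    then show ?case using per[of "i + int n * (k - 1)"] by (simp add: algebra_simps)
  qed simp
  have "int n dvd i - j" using assms(2) by (simp add: mod_eq_dvd_iff)
  then obtain k where "i = j + int n * k" by (metis dvdE diff_add_cancel add.commute)
  then show ?thesis using * by simp
qed

text \<open>A point that follows the periodic point \<open>q\<close> on both sides of a finite window is a translate of
  a two-sided point. The repeated word is a period of \<open>q\<close> read from the origin, so the two ends \<open>a\<close> and
  \<open>e\<close> of the window must both be placed where \<open>q\<close> is in phase \<open>0\<close>.\<close>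

lemma eventually_periodic_two_sided_point:
  fixes x q :: "int \<Rightarrow> 'a"
  assumes n: "n > 0" and per: "\<And>i. q (i + int n) = q i"
    and left: "\<And>i. i < 0 \<Longrightarrow> x (a + i) = q i" and ae: "a \<le> e"
    and right: "\<And>i. i \<ge> 0 \<Longrightarrow> x (e + i) = q i"
  shows "translate a x = two_sided_point (map (\<lambda>i. q (int i)) [0..<n]) (map (\<lambda>i. x (a + int i)) [0..<nat (e - a)])"
proof
  fix i
  have q: "q (int (nat (i mod int n))) = q i" "nat (i mod int n) < n" for i
    using n periodic_cong[of q n, OF per, of "i mod int n" i] by (simp_all add: nat_less_iff)
  show "translate a x i = two_sided_point (map (\<lambda>i. q (int i)) [0..<n]) (map (\<lambda>i. x (a + int i)) [0..<nat (e - a)]) i"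
    using left[of i] right[of "i - (e - a)"] ae q
    by (auto simp: two_sided_point_def translate_def algebra_simps)
qed

lemma two_sided_point_periodic:
  assumes n: "n > 0" and per: "\<And>i. q (i + int n) = q i"
  shows "q = two_sided_point (map (\<lambda>i. q (int i)) [0..<n]) []"
  using eventually_periodic_two_sided_point[where x = q and q = q and a = 0 and e = 0, OF n per] by simp

text \<open>An isolated point \<open>q\<close> of \<open>M\<close> exists, and by minimality every orbit of \<open>M\<close> accumulates
  at it. So \<open>M\<close> is the single orbit of \<open>q\<close>, all of its points are isolated, and a compact set all of
  whose points are isolated is finite.\<close>

lemma minimal_countable_subshift:
  fixes M :: "(int \<Rightarrow> 'a::finite) set"
  assumes M: "subshift M" "countable M" "M \<noteq> {}"
    and minimal: "\<And>Y. subshift Y \<Longrightarrow> Y \<subseteq> M \<Longrightarrow> Y \<noteq> {} \<Longrightarrow> Y = M"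
  obtains q n where "n > 0" "\<And>i. q (i + int n) = q i" "M = orbit q" "finite M"
proof -
  obtain q where q: "q \<in> M" "q \<notin> full_shift_topology derived_set_of M"
    using countable_subshift_isolated_point[OF M] .
  have "orbit_closure z = M" if "z \<in> M" for z
    using that minimal[OF subshift_orbit_closure orbit_closure_subset_subshift[OF M(1)]]
      orbit_subset_orbit_closure[of z] self_in_orbit[of z] by blast
  then have "M \<subseteq> orbit q"
    using orbit_of_isolated_point[OF M(1) q(2,1)] q(1) by blast
  then have M_eq: "M = orbit q" using orbit_subset_subshift[OF M(1) q(1)] by blast
  then have "M \<inter> full_shift_topology derived_set_of M = {}"
    using isolated_translate[OF M(1) q(2)] by (auto simp: orbit_eq)
  then have "finite M"
    using M(1) by (intro finite_closed_isolated) (auto simp: subshift_iff)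
  then show ?thesis
    using finite_orbit_periodic[of q] that M_eq by metis
qed

text \<open>The points of \<open>X\<close> that differ from all points of \<open>M\<close> somewhere on the window form a closed
  set of isolated points, which is finite by compactness. Since \<open>y\<close> is not periodic, only finitely many
  of its translates lie in that set.\<close>

lemma isolated_point_eventually_in_window:
  fixes X M :: "(int \<Rightarrow> 'a::finite) set"
  assumes X: "subshift X" and M: "M \<subseteq> X" "finite M"
    and y: "y \<in> X" "y \<notin> full_shift_topology derived_set_of X" "infinite (orbit y)"
    and XM: "X = orbit y \<union> M"
  obtains K :: int where "K \<ge> 0" "\<And>k. \<bar>k\<bar> \<ge> K \<Longrightarrow> \<exists>q\<in>M. \<forall>i\<in>{0..n}. y (k + i) = q i"
proof -
  define U where "U = (\<Union>q\<in>M. {x. \<forall>i\<in>{0..n}. x i = q i})"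
  have "openin full_shift_topology {x. \<forall>i\<in>I. x i = q i}" if "finite I" for I and q :: "int \<Rightarrow> 'a"
    using that
  proof (induction I rule: finite_induct)
    case empty
    show ?case using openin_topspace[of full_shift_topology] by simp
  next
    case (insert j I)
    have "{x. \<forall>i\<in>insert j I. x i = q i} = {x. x j = q j} \<inter> {x. \<forall>i\<in>I. x i = q i}" by auto
    then show ?case using openin_Int[OF openin_coordinate insert.IH] by simp
  qed
  then have "openin full_shift_topology U" unfolding U_def by (intro openin_Union) auto
  then have "closedin full_shift_topology (X - U)" using X by (intro closedin_diff) (auto simp: subshift_iff)
  moreover have "(X - U) \<inter> full_shift_topology derived_set_of (X - U) = {}"
  proof -
    have "X - U \<subseteq> orbit y" using XM by (auto simp: U_def)
    then have "(X - U) \<inter> full_shift_topology derived_set_of X = {}"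
      using isolated_translate[OF X y(2)] by (auto simp: orbit_eq)
    then show ?thesis using derived_set_of_mono[of "X - U" X full_shift_topology] by blast
  qed
  ultimately have fin: "finite (X - U)" by (rule finite_closed_isolated)
  \<comment> \<open>Two equal translates would make \<open>y\<close> periodic and its orbit finite.\<close>
  have inj: "inj (\<lambda>k. translate k y)"
  proof (rule injI, rule ccontr)
    fix k l assume kl: "translate k y = translate l y" "k \<noteq> l"
    define n where "n = nat \<bar>k - l\<bar>"
    have n: "n > 0" using kl(2) by (simp add: n_def)
    have "y (i + int n) = y i" for i
      using fun_cong[OF kl(1), of "i - l"] fun_cong[OF kl(1), of "i - k"]
      by (cases "k \<ge> l") (simp_all add: translate_def n_def algebra_simps)
    then have *: "y i = y j" if "i mod int n = j mod int n" for i j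
      using that by (rule periodic_cong)
    have "translate k y = translate (k mod int n) y" for k
      unfolding translate_def by (rule ext, rule *) (simp add: mod_add_right_eq)
    then have "orbit y \<subseteq> (\<lambda>k. translate k y) ` {0..<int n}"
      unfolding orbit_eq by (intro image_subsetI) (metis atLeastLessThan_iff image_eqI n of_nat_0_less_iff pos_mod_bound pos_mod_sign)
    then show False using y(3) finite_subset by blast
  qed
  have "finite {k. translate k y \<in> X - U}"
    using finite_vimageI[OF fin inj] by (simp add: vimage_def)
  then have "\<bar>k\<bar> \<le> Max ((\<lambda>k. \<bar>k\<bar>) ` {k. translate k y \<in> X - U})" if "translate k y \<in> X - U" for k
    using that by (intro Max_ge finite_imageI imageI) simp_all
  then obtain K where K: "\<And>k. translate k y \<in> X - U \<Longrightarrow> \<bar>k\<bar> \<le> K" by blast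
  show ?thesis
  proof (rule that[of "max 0 K + 1"])
    fix k :: int assume "\<bar>k\<bar> \<ge> max 0 K + 1"
    then have "translate k y \<in> U" using K[of k] translate_in_subshift[OF X y(1)] by fastforce
    then show "\<exists>q\<in>M. \<forall>i\<in>{0..n}. y (k + i) = q i"
      by (auto simp: U_def translate_def add_ac)
  qed simp
qed

text \<open>Windows of length one more than the period suffice: agreement with an \<open>n\<close>-periodic point on
  \<open>{0..n}\<close> forces \<open>y (k + n) = y k\<close>. So \<open>y\<close> is periodic on both half-lines outside \<open>{-K<..<K}\<close>, where it
  copies points \<open>q\<close> and \<open>r\<close> of the same periodic orbit.\<close>

lemma homoclinic_two_sided_point:
  fixes y q0 :: "int \<Rightarrow> 'a"
  assumes n: "n > 0" and per0: "\<And>i. q0 (i + int n) = q0 i" and "K \<ge> 0"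
    and window: "\<And>k. \<bar>k\<bar> \<ge> K \<Longrightarrow> \<exists>q\<in>orbit q0. \<forall>i\<in>{0..int n}. y (k + i) = q i"
  obtains u v where "u \<noteq> []" "orbit y = orbit (two_sided_point u v)" "orbit q0 = orbit (two_sided_point u [])"
proof -
  have per: "q (i + int n) = q i" if "q \<in> orbit q0" for q i
  proof -
    obtain k where "q = translate k q0" using \<open>q \<in> orbit q0\<close> by (auto simp: orbit_eq)
    then show ?thesis using per0[of "i + k"] by (simp add: translate_def add_ac)
  qed
  have y_per: "y (k + int n) = y k" if k: "\<bar>k\<bar> \<ge> K" for k
  proof -
    obtain q where q: "q \<in> orbit q0" "\<forall>i\<in>{0..int n}. y (k + i) = q i" using window[OF k] by blast
    then show ?thesis
      using per[OF q(1), of 0] bspec[OF q(2), of 0] bspec[OF q(2), of "int n"] by simp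
  qed
  obtain q where q: "q \<in> orbit q0" "\<forall>i\<in>{0..int n}. y (- K + i) = q i"
    using window[of "- K"] \<open>K \<ge> 0\<close> by auto
  obtain r where r: "r \<in> orbit q0" "\<forall>i\<in>{0..int n}. y (K + i) = r i"
    using window[of K] \<open>K \<ge> 0\<close> by auto
  have left: "y (- K - int j) = q (- int j)" for j
  proof (induction j rule: less_induct)
    case (less j)
    have step: "y (- K - int j) = y (- K - int j + int n)"
      using y_per[of "- K - int j"] \<open>K \<ge> 0\<close> by simp
    show ?case
    proof (cases "j \<ge> n")
      case True
      then have "y (- K - int (j - n)) = q (- int (j - n))" using less[of "j - n"] n by simp
      then show ?thesis using True step per[OF q(1), of "- int j"] by (simp add: of_nat_diff algebra_simps)
    next
      case False
      then have "y (- K + (int n - int j)) = q (int n - int j)" using q(2) by simp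
      then show ?thesis using step per[OF q(1), of "- int j"] by (simp add: algebra_simps)
    qed
  qed
  have right: "y (K + int j) = r (int j)" for j
  proof (induction j rule: less_induct)
    case (less j)
    show ?case
    proof (cases "j \<ge> n")
      case True
      then have "y (K + int (j - n)) = r (int (j - n))" using less[of "j - n"] n by simp
      then show ?thesis
        using True y_per[of "K + int (j - n)"] per[OF r(1), of "int (j - n)"] \<open>K \<ge> 0\<close>
        by (simp add: of_nat_diff algebra_simps)
    qed (use r(2) in simp)
  qed
  have "r \<in> orbit q" using q(1) r(1) orbit_eqI by blast
  then obtain s where s: "r = translate s q" by (auto simp: orbit_eq)
  \<comment> \<open>Moving the right end of the window by \<open>t\<close> brings the right tail into phase with \<open>q\<close>.\<close>
  define t where "t = (- s) mod int n"
  have t: "t \<ge> 0" "(t + s) mod int n = 0" using n by (auto simp: t_def mod_add_left_eq)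
  define u where "u = map (\<lambda>i. q (int i)) [0..<n]"
  define v where "v = map (\<lambda>i. y (- K + int i)) [0..<nat (K + t - (- K))]"
  have "translate (- K) y = two_sided_point u v"
    unfolding u_def v_def
  proof (rule eventually_periodic_two_sided_point[where q = q, OF n per[OF q(1)]])
    show "y (- K + i) = q i" if "i < 0" for i
      using left[of "nat (- i)"] that by simp
    show "- K \<le> K + t" using t \<open>K \<ge> 0\<close> by simp
    show "y (K + t + i) = q i" if "i \<ge> 0" for i
    proof -
      have "y (K + t + i) = r (t + i)" using right[of "nat (t + i)"] t that by (simp add: add_ac)
      also have "\<dots> = q (i + (t + s))" by (simp add: s translate_def add_ac)
      also have "\<dots> = q i"
        using t(2) mod_add_right_eq[of i "t + s" "int n"] by (intro periodic_cong[of q n, OF per[OF q(1)]]) simp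
      finally show ?thesis .
    qed
  qed
  then have "orbit y = orbit (two_sided_point u v)"
    using orbit_translate[of "- K" y] by (simp only:)
  moreover have "q = two_sided_point u []"
    unfolding u_def using n per[OF q(1)] by (rule two_sided_point_periodic)
  then have "orbit q0 = orbit (two_sided_point u [])"
    using orbit_eqI[OF q(1)] by (simp only:)
  moreover have "u \<noteq> []"
    using n by (simp add: u_def)
  ultimately show ?thesis
    using that by blast
qed

text \<open>If \<open>X\<close> is not minimal, its subshifts are exactly \<open>{}\<close>, a minimal \<open>M\<close> and \<open>X\<close>, so every point
  outside \<open>M\<close> has dense orbit. An isolated point \<open>y\<close> of \<open>X\<close> lies outside \<open>M\<close>, hence every point
  outside \<open>M\<close> is in its orbit.\<close>

theorem countable_subshift_two_sided_point:
  fixes X :: "(int \<Rightarrow> 'a::finite) set"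
  assumes X: "subshift X" "countable X" "num_subshifts X \<le> 3" "X \<noteq> {}"
  obtains u v where "u \<noteq> []" "X = orbit_closure (two_sided_point u v)"
    "X = orbit (two_sided_point u v) \<union> orbit (two_sided_point u [])"
proof (cases "\<forall>Y. subshift Y \<and> Y \<subseteq> X \<and> Y \<noteq> {} \<longrightarrow> Y = X")
  case True
  then obtain q n where q: "n > 0" "\<And>i. q (i + int n) = q i" "X = orbit q" "finite X"
    using minimal_countable_subshift[OF X(1,2,4)] by metis
  define u where "u = map (\<lambda>i. q (int i)) [0..<n]"
  have "q = two_sided_point u []" unfolding u_def using q(1,2) by (rule two_sided_point_periodic)
  moreover have "orbit_closure q = X"
    using True subshift_orbit_closure orbit_closure_subset_subshift[OF X(1), of q]
      orbit_subset_orbit_closure[of q] q(3) by auto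
  ultimately show ?thesis using that[of u "[]"] q(1,3) by (simp add: u_def)
next
  case False
  then obtain M where M: "subshift M" "M \<subseteq> X" "M \<noteq> {}" "M \<noteq> X" by blast
  let ?S = "{Y. subshift Y \<and> Y \<subseteq> X}"
  have "finite ?S"
    using X(3) by (auto simp: num_subshifts_def split: if_splits)
  moreover have "card ?S \<le> 3"
    using X(3) \<open>finite ?S\<close> by (simp add: num_subshifts_def numeral_eq_enat)
  moreover have "subshift ({} :: (int \<Rightarrow> 'a) set)" by (simp add: subshift_iff)
  then have "{{}, M, X} \<subseteq> ?S" using M X(1) by auto
  moreover have "card {{}, M, X} = 3" using M X(4) by simp
  ultimately have "{{}, M, X} = ?S" by (intro card_seteq) auto
  then have three: "Y = {} \<or> Y = M \<or> Y = X" if "subshift Y" "Y \<subseteq> X" for Y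
    using that by blast
  have "countable M" using M(2) X(2) countable_subset by blast
  then obtain q n where q: "n > 0" "\<And>i. q (i + int n) = q i" "M = orbit q" "finite M"
    using minimal_countable_subshift[OF M(1) _ M(3)] three M(2,4) by (metis subset_trans subset_antisym)
  obtain y where y: "y \<in> X" "y \<notin> full_shift_topology derived_set_of X"
    using countable_subshift_isolated_point[OF X(1,2,4)] .
  have "y \<notin> M"
  proof
    assume "y \<in> M"
    \<comment> \<open>Then every point of the orbit \<open>M\<close> is isolated in \<open>X\<close>, so that \<open>X - M\<close> is a fourth subshift.\<close>
    then have M_eq: "M = orbit y" using q(3) orbit_eqI by blast
    then have M_isolated: "z \<notin> full_shift_topology derived_set_of X" if "z \<in> M" for z
      using isolated_translate[OF X(1) y(2)] that by (auto simp: orbit_eq)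
    have "closedin full_shift_topology (X - M)"
      unfolding closedin_contains_derived_set
    proof
      have "full_shift_topology derived_set_of (X - M) \<subseteq> full_shift_topology derived_set_of X" by (rule derived_set_of_mono) auto
      moreover have "full_shift_topology derived_set_of X \<subseteq> X"
        using X(1) by (simp add: subshift_iff closedin_contains_derived_set)
      ultimately show "full_shift_topology derived_set_of (X - M) \<subseteq> X - M" using M_isolated by blast
    qed simp
    moreover have "translate k ` (X - M) = X - M" for k
      using X(1) M(1) by (simp add: subshift_iff image_set_diff[OF inj_translate])
    ultimately have "subshift (X - M)" by (simp add: subshift_iff)
    then show False using three[of "X - M"] M by blast
  qed
  have dense: "orbit_closure z = X" if "z \<in> X" "z \<notin> M" for z
    using three[OF subshift_orbit_closure orbit_closure_subset_subshift[OF X(1) that(1)]]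
      orbit_subset_orbit_closure[of z] self_in_orbit[of z] that(2) by blast
  then have XM: "X = orbit y \<union> M"
    using orbit_of_isolated_point[OF X(1) y(2,1)] y(1) orbit_subset_subshift[OF X(1) y(1)] M(2) by blast
  have "infinite (orbit y)"
  proof
    assume fin: "finite (orbit y)"
    have "closedin full_shift_topology (orbit y)"
      using fin Hausdorff_full_shift by (intro closedin_Hausdorff_finite) auto
    then have "orbit_closure y = orbit y" by (simp add: orbit_closure_def closure_of_closedin)
    then have "M \<subseteq> orbit y" using dense[OF y(1) \<open>y \<notin> M\<close>] M(2) by simp
    then show False using M(3) orbit_eqI q(3) \<open>y \<notin> M\<close> by (metis self_in_orbit subset_iff)
  qed
  from isolated_point_eventually_in_window[OF X(1) M(2) q(4) y this XM]
  obtain K :: int where K: "K \<ge> 0" "\<And>k. \<bar>k\<bar> \<ge> K \<Longrightarrow> \<exists>p\<in>M. \<forall>i\<in>{0..int n}. y (k + i) = p i"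
    by blast
  from homoclinic_two_sided_point[OF q(1,2) K(1) K(2)[unfolded q(3)]]
  obtain u v where uv: "u \<noteq> []" "orbit y = orbit (two_sided_point u v)" "orbit q = orbit (two_sided_point u [])"
    by blast
  have "X = orbit_closure (two_sided_point u v)"
    using dense[OF y(1) \<open>y \<notin> M\<close>] uv(2) by (simp add: orbit_closure_def)
  moreover have "X = orbit (two_sided_point u v) \<union> orbit (two_sided_point u [])"
    using XM uv(2,3) q(3) by simp
  ultimately show ?thesis using that[of u v] uv(1) by blast
qed

section \<open>Vertices visited infinitely often by paths in a finite graph\<close>

text \<open>Walks have positive length, so a single vertex counts as strongly connected only if it has a loop;
  these are the sets that an infinite path can visit infinitely often.\<close>

definition strongly_connected :: "('v \<times> 'v) set \<Rightarrow> 'v set \<Rightarrow> bool" where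
  "strongly_connected R V \<longleftrightarrow> V \<noteq> {} \<and> (\<forall>a\<in>V. \<forall>b\<in>V. (a, b) \<in> (R \<inter> V \<times> V)\<^sup>+)"

lemma strongly_connected_converse: "strongly_connected (R\<inverse>) V \<longleftrightarrow> strongly_connected R V"
proof -
  have "R\<inverse> \<inter> V \<times> V = (R \<inter> V \<times> V)\<inverse>" by auto
  then show ?thesis
    unfolding strongly_connected_def by (auto simp: trancl_converse)
qed

text \<open>From some time \<open>K\<close> on, the path stays inside the set of vertices that it visits infinitely often,
  and after that time it leads from each of these vertices to each of them.\<close>

lemma strongly_connected_inf_visited:
  fixes f :: "nat \<Rightarrow> 'v"
  assumes path: "\<And>n. (f n, f (Suc n)) \<in> R" and fin: "finite (range f)"
  defines "V \<equiv> {v. infinite {n. f n = v}}"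
  shows "strongly_connected R V" and "\<exists>K. \<forall>n\<ge>K. f n \<in> V"
proof -
  have "{n. f n \<notin> V} = (\<Union>v\<in>range f - V. {n. f n = v})" by auto
  moreover have "finite \<dots>"
    using fin by (auto simp: V_def)
  ultimately obtain K where K: "\<And>n. n \<ge> K \<Longrightarrow> f n \<in> V"
    by (metis (no_types, lifting) finite_nat_set_iff_bounded mem_Collect_eq not_le)
  then show "\<exists>K. \<forall>n\<ge>K. f n \<in> V" by blast
  have walk: "(f i, f (i + Suc k)) \<in> (R \<inter> V \<times> V)\<^sup>+" if "i \<ge> K" for i k
  proof (induction k)
    case 0
    have "(f i, f (Suc i)) \<in> R \<inter> V \<times> V" using path K that by simp
    then show ?case by auto
  next
    case (Suc k)
    have "(f (i + Suc k), f (i + Suc (Suc k))) \<in> R \<inter> V \<times> V" using path K that by simp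
    with Suc show ?case by (rule trancl_into_trancl)
  qed
  have late: "\<exists>n>m. f n = v" if "v \<in> V" for v m
    using that unfolding V_def infinite_nat_iff_unbounded by blast
  show "strongly_connected R V"
    unfolding strongly_connected_def
  proof (intro conjI ballI)
    show "V \<noteq> {}" using K by blast
    fix a b assume ab: "a \<in> V" "b \<in> V"
    obtain i where i: "i > K" "f i = a" using late ab by blast
    obtain j where j: "j > i" "f j = b" using late ab by blast
    from j(1) obtain k where "j = i + Suc k" using less_imp_Suc_add by auto
    then show "(a, b) \<in> (R \<inter> V \<times> V)\<^sup>+" using walk[of i k] i j by simp
  qed
qed

lemma rtrancl_obtain_path:
  assumes "(a, b) \<in> R\<^sup>*"
  obtains f :: "nat \<Rightarrow> 'v" and n where "f 0 = a" "f n = b" "\<And>i. i < n \<Longrightarrow> (f i, f (Suc i)) \<in> R"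
proof -
  obtain n where "(a, b) \<in> R ^^ n"
    using assms rtrancl_imp_relpow by blast
  then show ?thesis
    unfolding relpow_fun_conv using that by blast
qed

text \<open>By induction on the set of vertices to be covered: a closed walk through \<open>a\<close> is extended by a
  detour from \<open>a\<close> to the new vertex and back.\<close>

lemma strongly_connected_closed_walk:
  assumes sc: "strongly_connected R V" and fin: "finite V" and a: "a \<in> V"
  obtains f :: "nat \<Rightarrow> 'v" and n where "n > 0" "f 0 = a" "f n = a" "f ` {..<n} = V"
    "\<And>i. i < n \<Longrightarrow> (f i, f (Suc i)) \<in> R"
proof -
  let ?R = "R \<inter> V \<times> V"
  have "\<exists>f n. n > 0 \<and> f 0 = a \<and> f n = a \<and> S \<subseteq> f ` {..<n} \<and> (\<forall>i<n. (f i, f (Suc i)) \<in> ?R)"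
    if "finite S" "S \<subseteq> V" for S
    using that
  proof (induction S rule: finite_induct)
    case empty
    have "(a, a) \<in> ?R\<^sup>+" using sc a unfolding strongly_connected_def by blast
    then obtain n where "n > 0" "(a, a) \<in> ?R ^^ n" unfolding trancl_power by blast
    then show ?case unfolding relpow_fun_conv by blast
  next
    case (insert b S)
    then obtain f n where f: "n > 0" "f 0 = a" "f n = a" "S \<subseteq> f ` {..<n}"
      "\<And>i. i < n \<Longrightarrow> (f i, f (Suc i)) \<in> ?R" by auto
    have "(a, b) \<in> ?R\<^sup>+" "(b, a) \<in> ?R\<^sup>+"
      using sc a insert.prems unfolding strongly_connected_def by blast+
    then obtain k l where "k > 0" "(a, b) \<in> ?R ^^ k" "l > 0" "(b, a) \<in> ?R ^^ l"
      unfolding trancl_power by blast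
    then obtain g h where g: "g 0 = a" "g k = b" "\<And>i. i < k \<Longrightarrow> (g i, g (Suc i)) \<in> ?R"
      and h: "h 0 = b" "h l = a" "\<And>i. i < l \<Longrightarrow> (h i, h (Suc i)) \<in> ?R"
      unfolding relpow_fun_conv by blast
    \<comment> \<open>The walk \<open>f\<close>, followed by a detour \<open>g\<close> to the new vertex \<open>b\<close> and back along \<open>h\<close>.\<close>
    define w where
      "w i = (if i < n then f i else if i < n + k then g (i - n) else h (i - n - k))" for i
    have "(w i, w (Suc i)) \<in> ?R" if i: "i < n + k + l" for i
    proof -
      consider "Suc i < n" | "Suc i = n" | "i \<ge> n" "Suc i < n + k" | "i \<ge> n" "Suc i = n + k" | "i \<ge> n + k"
        by linarith
      then show ?thesis
      proof cases
        case 2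
        then show ?thesis using f(5)[of i] f(3) g(1) \<open>k > 0\<close> by (simp add: w_def)
      next
        case 3
        then show ?thesis using g(3)[of "i - n"] by (simp add: w_def Suc_diff_le)
      next
        case 4
        then have "(g (i - n), g (Suc (i - n))) \<in> ?R" "Suc (i - n) = k" using g(3)[of "i - n"] by auto
        then show ?thesis using 4 g(2) h(1) by (simp add: w_def)
      next
        case 5
        then show ?thesis using h(3)[of "i - n - k"] i by (simp add: w_def Suc_diff_le)
      qed (use f(5) in \<open>simp add: w_def\<close>)
    qed
    moreover have "w 0 = a" "w (n + k + l) = a"
      using f h \<open>l > 0\<close> by (simp_all add: w_def)
    moreover have "insert b S \<subseteq> w ` {..<n + k + l}"
    proof -
      have "b = w (n + k)" by (simp add: w_def h(1))
      moreover have "S \<subseteq> w ` {..<n}"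
        using f(4) by (auto simp: w_def)
      ultimately show ?thesis using \<open>l > 0\<close> by fastforce
    qed
    ultimately show ?case using f(1) by (intro exI[of _ w] exI[of _ "n + k + l"]) simp
  qed
  from this[OF fin order_refl] obtain f n where f: "n > 0" "f 0 = a" "f n = a" "V \<subseteq> f ` {..<n}"
    "\<And>i. i < n \<Longrightarrow> (f i, f (Suc i)) \<in> ?R" by blast
  moreover have "f ` {..<n} \<subseteq> V" using f(5) by auto
  ultimately show ?thesis using that[of n f] by blast
qed

text \<open>The infinite behaviour of a bi-infinite path consists of its behaviour in the past and in the
  future, and each of them is one strongly connected set. Conversely, closed walks that cover \<open>V1\<close> and
  \<open>V2\<close> are repeated forever in the past and in the future and joined by a finite path from \<open>a\<close> to \<open>b\<close>.\<close>

theorem bi_infinite_path_iff: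
  fixes R :: "('v \<times> 'v) set"
  assumes fin: "finite R"
  shows "(\<exists>h :: int \<Rightarrow> 'v. (\<forall>i. (h i, h (i + 1)) \<in> R) \<and> {v. infinite {i. h i = v}} = V) \<longleftrightarrow>
    (\<exists>V1 V2. V = V1 \<union> V2 \<and> strongly_connected R V1 \<and> strongly_connected R V2 \<and>
      (\<exists>a\<in>V1. \<exists>b\<in>V2. (a, b) \<in> R\<^sup>*))"
proof (intro iffI; elim exE conjE bexE)
  fix h :: "int \<Rightarrow> 'v"
  assume path: "\<forall>i. (h i, h (i + 1)) \<in> R" and V: "{v. infinite {i. h i = v}} = V"
  define f where "f n = h (int n)" for n
  define g where "g n = h (- int n)" for n
  define V1 where "V1 = {v. infinite {n. g n = v}}"
  define V2 where "V2 = {v. infinite {n. f n = v}}"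
  have rh: "range h \<subseteq> fst ` R" using path by force
  have pf: "(f n, f (Suc n)) \<in> R" for n
    using path[rule_format, of "int n"] by (simp add: f_def add.commute)
  have pg: "(g n, g (Suc n)) \<in> R\<inverse>" for n
    using path[rule_format, of "- int (Suc n)"] by (simp add: g_def)
  have rf: "finite (range f)" and rg: "finite (range g)"
    using finite_subset[OF rh] fin by (auto simp: f_def g_def intro: finite_subset[of _ "range h"])
  from strongly_connected_inf_visited[OF pf rf]
  obtain K2 where sc2: "strongly_connected R V2" and K2: "f K2 \<in> V2"
    unfolding V2_def by blast
  from strongly_connected_inf_visited[OF pg rg]
  obtain K1 where sc1: "strongly_connected R V1" and K1: "g K1 \<in> V1"
    unfolding V1_def strongly_connected_converse by blast
  have "(h i, h (i + int n)) \<in> R\<^sup>*" for i n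
  proof (induction n)
    case (Suc n)
    have "(h (i + int n), h (i + int (Suc n))) \<in> R"
      using path[rule_format, of "i + int n"] by (simp add: algebra_simps)
    with Suc show ?case by (rule rtrancl_into_rtrancl)
  qed simp
  from this[of "- int K1" "K1 + K2"] have "(g K1, f K2) \<in> R\<^sup>*" by (simp add: f_def g_def)
  moreover have "V = V1 \<union> V2"
  proof -
    have "infinite {i. h i = v} \<longleftrightarrow> infinite {n. g n = v} \<or> infinite {n. f n = v}" for v
    proof -
      have eq: "{i. h i = v} = (\<lambda>n. - int n) ` {n. g n = v} \<union> int ` {n. f n = v}" (is "_ = ?S")
      proof
        show "{i. h i = v} \<subseteq> ?S"
        proof
          fix i assume "i \<in> {i. h i = v}"
          then show "i \<in> ?S"
            by (cases "i \<ge> 0") (auto simp: f_def g_def image_iff intro: exI[of _ "nat i"] exI[of _ "nat (- i)"])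
        qed
      qed (auto simp: f_def g_def)
      have "inj_on (\<lambda>n. - int n) {n. g n = v}" "inj_on int {n. f n = v}" by (auto simp: inj_on_def)
      then show ?thesis unfolding eq by (simp add: finite_image_iff)
    qed
    then show ?thesis unfolding V[symmetric] V1_def V2_def by blast
  qed
  ultimately show "\<exists>V1 V2. V = V1 \<union> V2 \<and> strongly_connected R V1 \<and> strongly_connected R V2 \<and>
      (\<exists>a\<in>V1. \<exists>b\<in>V2. (a, b) \<in> R\<^sup>*)"
    using sc1 sc2 K1 K2 by blast
next
  fix V1 V2 a b
  assume V: "V = V1 \<union> V2" and sc: "strongly_connected R V1" "strongly_connected R V2"
    and ab: "a \<in> V1" "b \<in> V2" and conn: "(a, b) \<in> R\<^sup>*"
  have finV: "finite W" if "strongly_connected R W" for W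
  proof -
    have "W \<subseteq> fst ` R"
    proof
      fix a assume "a \<in> W"
      then have "(a, a) \<in> (R \<inter> W \<times> W)\<^sup>+" using that unfolding strongly_connected_def by blast
      then obtain c where "(a, c) \<in> R \<inter> W \<times> W" using tranclD by metis
      then show "a \<in> fst ` R" by force
    qed
    then show ?thesis using fin finite_subset by blast
  qed
  obtain f n where f: "n > 0" "f 0 = a" "f n = a" "f ` {..<n} = V1" "\<And>i. i < n \<Longrightarrow> (f i, f (Suc i)) \<in> R"
    using strongly_connected_closed_walk[OF sc(1) finV ab(1)] sc by metis
  obtain g k where g: "k > 0" "g 0 = b" "g k = b" "g ` {..<k} = V2" "\<And>i. i < k \<Longrightarrow> (g i, g (Suc i)) \<in> R"
    using strongly_connected_closed_walk[OF sc(2) finV ab(2)] sc by metis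
  obtain w m where w: "w 0 = a" "w m = b" "\<And>i. i < m \<Longrightarrow> (w i, w (Suc i)) \<in> R"
    using rtrancl_obtain_path[OF conn] by metis
  define h where "h i = (if i < 0 then f (nat (i mod int n))
    else if i < int m then w (nat i) else g (nat ((i - int m) mod int k)))" for i
  have cyc: "(F (nat (i mod int N)), F (nat ((i + 1) mod int N))) \<in> R"
    if "N > 0" "F N = F 0" "\<And>i. i < N \<Longrightarrow> (F i, F (Suc i)) \<in> R" for F :: "nat \<Rightarrow> 'v" and N i
  proof -
    let ?j = "i mod int N"
    have j: "0 \<le> ?j" "?j < int N" using that(1) by auto
    have "(F (nat ?j), F (Suc (nat ?j))) \<in> R" using j that(3) by simp
    moreover have "F (Suc (nat ?j)) = F (nat ((i + 1) mod int N))"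
    proof (cases "?j + 1 = int N")
      case True
      then have "(i + 1) mod int N = 0" by (metis mod_add_left_eq mod_self)
      moreover have "Suc (nat ?j) = N" using True j by linarith
      ultimately show ?thesis using that(2) by simp
    next
      case False
      then have "(i + 1) mod int N = ?j + 1"
        using j mod_add_left_eq[of i "int N" 1] mod_pos_pos_trivial[of "?j + 1" "int N"] by linarith
      then show ?thesis using j by (simp add: Suc_nat_eq_nat_zadd1 add.commute)
    qed
    ultimately show ?thesis by simp
  qed
  have in_range: "F (nat (i mod int N)) \<in> F ` {..<N}" if "N > 0" for F :: "nat \<Rightarrow> 'v" and N i
    using that by (intro imageI) (simp add: nat_less_iff)
  have "(h i, h (i + 1)) \<in> R" for i
  proof -
    consider "i < -1" | "i = -1" | "0 \<le> i" "i + 1 < int m" | "0 \<le> i" "i + 1 = int m" | "0 \<le> i" "i \<ge> int m"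
      by linarith
    then show ?thesis
    proof cases
      case 1
      then show ?thesis using cyc[of n f i] f by (simp add: h_def)
    next
      case 2
      then have "(h i, a) \<in> R" using cyc[of n f "-1"] f by (simp add: h_def)
      moreover have "h (i + 1) = a" using 2 w g by (cases m) (auto simp: h_def)
      ultimately show ?thesis by simp
    next
      case 3
      then show ?thesis using w(3)[of "nat i"] by (simp add: h_def Suc_nat_eq_nat_zadd1 add.commute)
    next
      case 4
      then show ?thesis using w(3)[of "nat i"] w(2) g(2)
        by (simp add: h_def Suc_nat_eq_nat_zadd1 add.commute)
    next
      case 5
      then show ?thesis using cyc[of k g "i - int m"] g by (simp add: h_def algebra_simps)
    qed
  qed
  moreover have "{v. infinite {i. h i = v}} = V"
  proof (intro equalityI subsetI)
    fix v assume v: "v \<in> {v. infinite {i. h i = v}}"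
    show "v \<in> V"
    proof (rule ccontr)
      assume "v \<notin> V"
      have "f (nat (i mod int n)) \<in> V1" for i
        using in_range[of n f i] f by simp
      moreover have "g (nat (i mod int k)) \<in> V2" for i
        using in_range[of k g i] g by simp
      ultimately have "{i. h i = v} \<subseteq> {0..<int m}"
        using \<open>v \<notin> V\<close> V by (auto simp: h_def split: if_splits)
      then show False using v finite_subset by auto
    qed
  next
    fix v assume "v \<in> V"
    then consider j where "j < n" "v = f j" | j where "j < k" "v = g j"
      using V f(4) g(4) by auto
    then have "\<exists>c d. d \<noteq> 0 \<and> (\<forall>t::nat. h (c + d * int t) = v)"
    proof cases
      case 1
      have "h ((int j - int n) + (- int n) * int t) = v" for t
      proof -
        have "int j - int n - int n * int t < 0"
          using 1(1) by (smt (verit) mult_nonneg_nonneg of_nat_0_le_iff of_nat_less_iff)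
        moreover have "(int j - int n - int n * int t) mod int n = int j"
        proof -
          have "(int j - int n - int n * int t) = int j + int n * (- 1 - int t)"
            by (simp add: algebra_simps)
          then have "(int j - int n - int n * int t) mod int n = int j mod int n"
            by (simp only: mod_mult_self2)
          then show ?thesis using 1(1) by simp
        qed
        ultimately show ?thesis using 1 by (simp add: h_def)
      qed
      then show ?thesis using f(1) by (intro exI[of _ "int j - int n"] exI[of _ "- int n"]) auto
    next
      case 2
      have "h ((int m + int j) + int k * int t) = v" for t
      proof -
        have "\<not> int j + int k * int t < 0" "\<not> int m + (int j + int k * int t) < 0"
          by (simp_all add: not_less)
        then show ?thesis using 2 by (simp add: h_def add.assoc)
      qed
      then show ?thesis using g(1) by (intro exI[of _ "int m + int j"] exI[of _ "int k"]) auto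
    qed
    then obtain c d where cd: "d \<noteq> 0" "\<And>t::nat. h (c + d * int t) = v" by blast
    have "inj (\<lambda>t::nat. c + d * int t)" using cd(1) by (auto simp: inj_def)
    then have "infinite (range (\<lambda>t::nat. c + d * int t))" using range_inj_infinite by blast
    moreover have "range (\<lambda>t::nat. c + d * int t) \<subseteq> {i. h i = v}" using cd(2) by auto
    ultimately show "v \<in> {v. infinite {i. h i = v}}" using infinite_super by blast
  qed
  ultimately show "\<exists>h :: int \<Rightarrow> 'v. (\<forall>i. (h i, h (i + 1)) \<in> R) \<and> {v. infinite {i. h i = v}} = V" by blast
qed

section \<open>Recursive functions and predicates\<close>

text \<open>Total recursive functions of a fixed arity. They act on environments given as lists, the \<open>i\<close>-th
  variable being the \<open>i\<close>-th entry; a bounded quantifier adds its variable at the front, so inside it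
  the outer variables are reached through \<^const>\<open>tl\<close>. With this convention, membership in the class can be
  proved by following the syntax of a term or formula.\<close>

definition computable :: "nat \<Rightarrow> (nat list \<Rightarrow> nat) \<Rightarrow> bool" where
  "computable n f \<longleftrightarrow> (\<exists>p. \<forall>xs. length xs = n \<longrightarrow> eval p xs (f xs))"

definition decidable :: "nat \<Rightarrow> (nat list \<Rightarrow> bool) \<Rightarrow> bool" where
  "decidable n P \<longleftrightarrow> computable n (\<lambda>xs. of_bool (P xs))"

lemma computable_cong:
  assumes "computable n f" "\<And>xs. length xs = n \<Longrightarrow> f xs = g xs"
  shows "computable n g"
  using assms unfolding computable_def by metis

lemma decidable_cong:
  assumes "decidable n P" "\<And>xs. length xs = n \<Longrightarrow> P xs \<longleftrightarrow> Q xs"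
  shows "decidable n Q"
  using assms(1) unfolding decidable_def by (rule computable_cong) (simp add: assms(2))

lemma computable_hd: "computable (Suc n) hd"
  unfolding computable_def
proof (intro exI allI impI)
  fix xs :: "nat list" assume "length xs = Suc n"
  then show "eval (Proj 0) xs (hd xs)"
    using eval.proj[of 0 xs] by (cases xs) auto
qed

text \<open>Weakening: the environment gains a variable at the front.\<close>

lemma computable_tl:
  assumes "computable n f"
  shows "computable (Suc n) (\<lambda>xs. f (tl xs))"
proof -
  obtain p where p: "\<And>xs. length xs = n \<Longrightarrow> eval p xs (f xs)"
    using assms unfolding computable_def by blast
  have "eval (Comp p (map (\<lambda>i. Proj (Suc i)) [0..<n])) xs (f (tl xs))" if "length xs = Suc n" for xs
  proof (rule eval.comp)
    show "list_all2 (\<lambda>g y. eval g xs y) (map (\<lambda>i. Proj (Suc i)) [0..<n]) (tl xs)"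
      using that eval.proj[of "Suc _" xs] by (auto simp: list_all2_conv_all_nth nth_tl)
    show "eval p (tl xs) (f (tl xs))"
      using that p by simp
  qed
  then show ?thesis unfolding computable_def by blast
qed

lemma computable_comp1:
  assumes "computable 1 (\<lambda>xs. F (hd xs))" "computable n f"
  shows "computable n (\<lambda>xs. F (f xs))"
proof -
  obtain p where "\<And>xs. length xs = 1 \<Longrightarrow> eval p xs (F (hd xs))"
    using assms(1) unfolding computable_def by blast
  from this[of "[_]"] have p: "\<And>a. eval p [a] (F a)" by simp
  obtain q where q: "\<And>xs. length xs = n \<Longrightarrow> eval q xs (f xs)"
    using assms(2) unfolding computable_def by blast
  have "eval (Comp p [q]) xs (F (f xs))" if "length xs = n" for xs
    using p q that by (intro eval.comp[where ys = "[f xs]"]) auto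
  then show ?thesis unfolding computable_def by blast
qed

lemma computable_comp2:
  assumes "computable 2 (\<lambda>xs. F (hd xs) (hd (tl xs)))" "computable n f" "computable n g"
  shows "computable n (\<lambda>xs. F (f xs) (g xs))"
proof -
  obtain p where "\<And>xs. length xs = 2 \<Longrightarrow> eval p xs (F (hd xs) (hd (tl xs)))"
    using assms(1) unfolding computable_def by blast
  from this[of "[_, _]"] have p: "\<And>a b. eval p [a, b] (F a b)" by simp
  obtain q where q: "\<And>xs. length xs = n \<Longrightarrow> eval q xs (f xs)"
    using assms(2) unfolding computable_def by blast
  obtain r where r: "\<And>xs. length xs = n \<Longrightarrow> eval r xs (g xs)"
    using assms(3) unfolding computable_def by blast
  have "eval (Comp p [q, r]) xs (F (f xs) (g xs))" if "length xs = n" for xs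
    using p q r that by (intro eval.comp[where ys = "[f xs, g xs]"]) auto
  then show ?thesis unfolding computable_def by blast
qed

lemma computable_Suc:
  assumes "computable n f"
  shows "computable n (\<lambda>xs. Suc (f xs))"
proof (rule computable_comp1[OF _ assms])
  have "eval Succ xs (Suc (hd xs))" if "length xs = 1" for xs
    using that eval.succ by (cases xs) auto
  then show "computable 1 (\<lambda>xs. Suc (hd xs))"
    unfolding computable_def by blast
qed

lemma computable_const: "computable n (\<lambda>_. c)"
proof (induction c)
  case 0
  then show ?case unfolding computable_def using eval.zero by blast
qed (rule computable_Suc)

lemma computable_primrec:
  assumes "computable 1 (\<lambda>xs. F 0 (hd xs))"
    and "computable 3 (\<lambda>xs. G (hd xs) (hd (tl xs)) (hd (tl (tl xs))))"
    and "\<And>n b. F (Suc n) b = G n (F n b) b"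
    and "computable n f" "computable n g"
  shows "computable n (\<lambda>xs. F (f xs) (g xs))"
proof -
  obtain p where "\<And>xs. length xs = 1 \<Longrightarrow> eval p xs (F 0 (hd xs))"
    using assms(1) unfolding computable_def by blast
  from this[of "[_]"] have p: "\<And>b. eval p [b] (F 0 b)" by simp
  obtain q where "\<And>xs. length xs = 3 \<Longrightarrow> eval q xs (G (hd xs) (hd (tl xs)) (hd (tl (tl xs))))"
    using assms(2) unfolding computable_def by blast
  from this[of "[_, _, _]"] have q: "\<And>a b c. eval q [a, b, c] (G a b c)" by simp
  have *: "eval (PrimRec p q) [n, b] (F n b)" for n b
  proof (induction n)
    case 0
    then show ?case using p by (rule eval.primrec_0)
  next
    case (Suc n)
    then show ?case using q by (auto simp: assms(3) intro: eval.primrec_Suc)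
  qed
  have "eval (PrimRec p q) xs (F (hd xs) (hd (tl xs)))" if "length xs = 2" for xs
    using *[of "hd xs" "hd (tl xs)"] that by (auto simp: numeral_2_eq_2 length_Suc_conv)
  then have "computable 2 (\<lambda>xs. F (hd xs) (hd (tl xs)))"
    unfolding computable_def by blast
  then show ?thesis using assms(4,5) by (rule computable_comp2)
qed

lemmas computable_var =
  computable_hd
  computable_hd[THEN computable_tl]
  computable_hd[THEN computable_tl, THEN computable_tl]

lemma computable_add:
  assumes "computable n f" "computable n g"
  shows "computable n (\<lambda>xs. f xs + g xs)"
proof (rule computable_primrec[where G = "\<lambda>_ y _. Suc y", OF _ _ _ assms])
  show "computable 1 (\<lambda>xs. 0 + hd xs)"
    using computable_hd by simp
  show "computable 3 (\<lambda>xs. Suc (hd (tl xs)))"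
    unfolding numeral_3_eq_3 by (intro computable_Suc computable_var)
qed simp

lemma computable_mult:
  assumes "computable n f" "computable n g"
  shows "computable n (\<lambda>xs. f xs * g xs)"
proof (rule computable_primrec[where G = "\<lambda>_ y b. b + y", OF _ _ _ assms])
  show "computable 1 (\<lambda>xs. 0 * hd xs)"
    using computable_const by simp
  show "computable 3 (\<lambda>xs. hd (tl (tl xs)) + hd (tl xs))"
    unfolding numeral_3_eq_3 by (intro computable_add computable_var)
qed simp

lemma computable_power:
  assumes "computable n f" "computable n g"
  shows "computable n (\<lambda>xs. f xs ^ g xs)"
proof (rule computable_primrec[where G = "\<lambda>_ y b. b * y", OF _ _ _ assms(2,1)])
  show "computable 1 (\<lambda>xs. hd xs ^ 0)"
    using computable_const by simp
  show "computable 3 (\<lambda>xs. hd (tl (tl xs)) * hd (tl xs))"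
    unfolding numeral_3_eq_3 by (intro computable_mult computable_var)
qed simp

lemma computable_diff:
  assumes "computable n f" "computable n g"
  shows "computable n (\<lambda>xs. f xs - g xs)"
proof -
  have pred: "computable n (\<lambda>xs. h xs - 1)" if "computable n h" for n h
  proof (rule computable_primrec[where F = "\<lambda>m _. m - 1" and G = "\<lambda>m _ _. m", OF _ _ _ that that])
    show "computable 1 (\<lambda>_. 0 - 1)" by (rule computable_const)
    show "computable 3 hd"
      unfolding numeral_3_eq_3 by (rule computable_hd)
  qed simp
  show ?thesis
  proof (rule computable_primrec[where G = "\<lambda>_ y _. y - 1", OF _ _ _ assms(2,1)])
    show "computable 1 (\<lambda>xs. hd xs - 0)"
      using computable_hd by simp
    show "computable 3 (\<lambda>xs. hd (tl xs) - 1)"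
      unfolding numeral_3_eq_3 by (intro pred computable_var)
  qed simp
qed

lemma decidable_not:
  assumes "decidable n P"
  shows "decidable n (\<lambda>xs. \<not> P xs)"
  using computable_diff[OF computable_const[of n 1] assms[unfolded decidable_def]]
  unfolding decidable_def by (rule computable_cong) simp

lemma decidable_and:
  assumes "decidable n P" "decidable n Q"
  shows "decidable n (\<lambda>xs. P xs \<and> Q xs)"
  using computable_mult[OF assms[unfolded decidable_def]]
  unfolding decidable_def by (rule computable_cong) simp

lemma decidable_or:
  assumes "decidable n P" "decidable n Q"
  shows "decidable n (\<lambda>xs. P xs \<or> Q xs)"
  using decidable_not[OF decidable_and[OF assms[THEN decidable_not]]]
  by (rule decidable_cong) blast

lemma decidable_imp:
  assumes "decidable n P" "decidable n Q"
  shows "decidable n (\<lambda>xs. P xs \<longrightarrow> Q xs)"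
  using decidable_or[OF decidable_not[OF assms(1)] assms(2)]
  by (rule decidable_cong) blast

lemma decidable_iff:
  assumes "decidable n P" "decidable n Q"
  shows "decidable n (\<lambda>xs. P xs \<longleftrightarrow> Q xs)"
  using decidable_and[OF decidable_imp[OF assms] decidable_imp[OF assms(2,1)]]
  by (rule decidable_cong) blast

lemma decidable_less:
  assumes "computable n f" "computable n g"
  shows "decidable n (\<lambda>xs. f xs < g xs)"
proof -
  have "computable n (\<lambda>xs. 1 - (1 - (g xs - f xs)))"
    by (intro computable_diff computable_const assms)
  then show ?thesis
    unfolding decidable_def by (rule computable_cong) simp
qed

lemma decidable_eq:
  assumes "computable n f" "computable n g"
  shows "decidable n (\<lambda>xs. f xs = g xs)"
proof -
  have "decidable n (\<lambda>xs. \<not> f xs < g xs \<and> \<not> g xs < f xs)"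
    by (intro decidable_and decidable_not decidable_less assms)
  then show ?thesis by (rule decidable_cong) auto
qed

text \<open>The search \<open>Mu\<close> looks for the value 0, so it is applied to the characteristic function of the
  negation.\<close>

lemma computable_Least:
  assumes P: "decidable (Suc n) (\<lambda>xs. P (hd xs) (tl xs))"
    and ex: "\<And>xs. \<exists>k. P k xs"
  shows "computable n (\<lambda>xs. LEAST k. P k xs)"
proof -
  obtain p where "\<And>xs. length xs = Suc n \<Longrightarrow> eval p xs (of_bool (\<not> P (hd xs) (tl xs)))"
    using decidable_not[OF P] unfolding decidable_def computable_def by blast
  from this[of "_ # _"]
  have p: "eval p (k # xs) (of_bool (\<not> P k xs))" if "length xs = n" for k xs
    using that by simp
  have "eval (Mu p) xs (LEAST k. P k xs)" if "length xs = n" for xs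
  proof (rule eval.mu)
    show "eval p ((LEAST k. P k xs) # xs) 0"
      using p[OF that, of "LEAST k. P k xs"] LeastI_ex[OF ex[of xs]] by simp
    show "\<forall>m < (LEAST k. P k xs). \<exists>y. eval p (m # xs) (Suc y)"
      using p[OF that] not_less_Least[of _ "\<lambda>k. P k xs"] by (metis One_nat_def of_bool_eq(2))
  qed
  then show ?thesis unfolding computable_def by blast
qed

text \<open>A bounded quantifier needs only one unbounded search that is stopped at the bound: a witness exists
  iff the search ends before the bound.\<close>

lemma decidable_bex:
  assumes f: "computable n f" and P: "decidable (Suc n) (\<lambda>xs. P (hd xs) (tl xs))"
  shows "decidable n (\<lambda>xs. \<exists>k<f xs. P k xs)"
proof -
  let ?l = "\<lambda>xs. LEAST k. P k xs \<or> \<not> k < f xs"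
  have "computable n ?l"
    by (rule computable_Least)
      (auto intro!: decidable_or decidable_not decidable_less computable_hd computable_tl f P)
  then have "decidable n (\<lambda>xs. ?l xs < f xs)"
    by (rule decidable_less[OF _ f])
  then show ?thesis
  proof (rule decidable_cong)
    fix xs
    show "?l xs < f xs \<longleftrightarrow> (\<exists>k<f xs. P k xs)"
      using LeastI[of "\<lambda>k. P k xs \<or> \<not> k < f xs" "f xs"] Least_le[of "\<lambda>k. P k xs \<or> \<not> k < f xs"]
      by (meson less_irrefl order.strict_trans1)
  qed
qed

lemma decidable_ball:
  assumes "computable n f" "decidable (Suc n) (\<lambda>xs. P (hd xs) (tl xs))"
  shows "decidable n (\<lambda>xs. \<forall>k<f xs. P k xs)"
  using decidable_not[OF decidable_bex[OF assms(1) decidable_not[OF assms(2)]]] by simp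

lemmas decidable_intros = decidable_bex decidable_ball decidable_not decidable_and decidable_or
  decidable_imp decidable_iff decidable_less decidable_eq
lemmas computable_intros = computable_hd computable_const computable_Suc computable_add computable_mult
  computable_power computable_diff

text \<open>The binary digit of \<open>x\<close> at position \<open>n\<close> is 1 iff \<open>x div 2 ^ n\<close> is odd; the quotient \<open>2 * a + 1\<close> and
  the remainder \<open>b\<close> are bounded, which makes membership in a coded set decidable.\<close>

lemma mem_set_decode_iff:
  "n \<in> set_decode x \<longleftrightarrow> (\<exists>a<Suc x. \<exists>b<2 ^ n. x = (2 * a + 1) * 2 ^ n + b)"
proof
  assume "n \<in> set_decode x"
  then have "odd (x div 2 ^ n)" by (simp add: set_decode_def)
  then obtain a where "x div 2 ^ n = 2 * a + 1" by (rule oddE)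
  then have "x = (2 * a + 1) * 2 ^ n + x mod 2 ^ n"
    by (metis div_mult_mod_eq)
  moreover have "a \<le> x"
    using \<open>x div 2 ^ n = 2 * a + 1\<close> div_le_dividend[of x "2 ^ n"] by linarith
  ultimately show "\<exists>a<Suc x. \<exists>b<2 ^ n. x = (2 * a + 1) * 2 ^ n + b"
    by (intro exI[of _ a] conjI exI[of _ "x mod 2 ^ n"]) auto
next
  assume "\<exists>a<Suc x. \<exists>b<2 ^ n. x = (2 * a + 1) * 2 ^ n + b"
  then obtain a b where "b < 2 ^ n" "x = (2 * a + 1) * 2 ^ n + b" by blast
  then have "x div 2 ^ n = 2 * a + 1" by (simp only: div_mult_self3) simp
  then show "n \<in> set_decode x" by (simp add: set_decode_def)
qed

lemma decidable_set_decode: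
  assumes "computable n f" "computable n g"
  shows "decidable n (\<lambda>xs. f xs \<in> set_decode (g xs))"
  unfolding mem_set_decode_iff
  by (intro decidable_intros computable_intros assms computable_tl)

lemma computable_prod_encode:
  assumes "computable n f" "computable n g"
  shows "computable n (\<lambda>xs. prod_encode (f xs, g xs))"
proof -
  have tri: "computable n (\<lambda>xs. triangle (h xs))" if "computable n h" for h
  proof (rule computable_primrec[where F = "\<lambda>m _. triangle m" and G = "\<lambda>m y _. y + Suc m", OF _ _ _ that that])
    show "computable 1 (\<lambda>_. triangle 0)" by (rule computable_const)
    show "computable 3 (\<lambda>xs. hd (tl xs) + Suc (hd xs))"
      unfolding numeral_3_eq_3 by (intro computable_intros computable_tl)
  qed simp
  show ?thesis
    unfolding prod_encode_def by (simp, intro tri computable_add assms)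
qed

lemma computable_fst_decode:
  assumes "computable n f"
  shows "computable n (\<lambda>xs. fst (prod_decode (f xs)))"
proof -
  have dec: "(\<exists>b<Suc x. prod_encode (a, b) = x) \<longleftrightarrow> fst (prod_decode x) = a" for a x
    using le_prod_encode_2 by (metis le_imp_less_Suc prod_decode_inverse prod_encode_inverse prod.collapse fst_conv)
  have "computable n (\<lambda>xs. LEAST a. \<exists>b<Suc (f xs). prod_encode (a, b) = f xs)"
    by (rule computable_Least)
      (intro decidable_intros computable_intros computable_prod_encode assms computable_tl, simp add: dec)
  moreover have "(LEAST a. k = a) = k" for k :: nat
    by (rule Least_equality) auto
  ultimately show ?thesis
    by (simp add: dec)
qed

lemma computable_snd_decode:
  assumes "computable n f"
  shows "computable n (\<lambda>xs. snd (prod_decode (f xs)))"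
proof -
  have dec: "(\<exists>a<Suc x. prod_encode (a, b) = x) \<longleftrightarrow> snd (prod_decode x) = b" for b x
    using le_prod_encode_1 by (metis le_imp_less_Suc prod_decode_inverse prod_encode_inverse prod.collapse snd_conv)
  have "computable n (\<lambda>xs. LEAST b. \<exists>a<Suc (f xs). prod_encode (a, b) = f xs)"
    by (rule computable_Least)
      (intro decidable_intros computable_intros computable_prod_encode assms computable_tl, simp add: dec)
  moreover have "(LEAST a. k = a) = k" for k :: nat
    by (rule Least_equality) auto
  ultimately show ?thesis
    by (simp add: dec)
qed

section \<open>Decidable properties of coded graphs\<close>

lemma computable_comp3:
  assumes "computable 3 (\<lambda>xs. F (hd xs) (hd (tl xs)) (hd (tl (tl xs))))"
    and "computable n f" "computable n g" "computable n h"
  shows "computable n (\<lambda>xs. F (f xs) (g xs) (h xs))"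
proof -
  obtain p where "\<And>xs. length xs = 3 \<Longrightarrow> eval p xs (F (hd xs) (hd (tl xs)) (hd (tl (tl xs))))"
    using assms(1) unfolding computable_def by blast
  from this[of "[_, _, _]"] have p: "\<And>a b c. eval p [a, b, c] (F a b c)" by simp
  obtain q where q: "\<And>xs. length xs = n \<Longrightarrow> eval q xs (f xs)"
    using assms(2) unfolding computable_def by blast
  obtain r where r: "\<And>xs. length xs = n \<Longrightarrow> eval r xs (g xs)"
    using assms(3) unfolding computable_def by blast
  obtain s where s: "\<And>xs. length xs = n \<Longrightarrow> eval s xs (h xs)"
    using assms(4) unfolding computable_def by blast
  have "eval (Comp p [q, r, s]) xs (F (f xs) (g xs) (h xs))" if "length xs = n" for xs
    using p q r s that by (intro eval.comp[where ys = "[f xs, g xs, h xs]"]) auto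
  then show ?thesis unfolding computable_def by blast
qed

lemma set_decode_le: "n \<in> set_decode w \<Longrightarrow> 2 ^ n \<le> w"
  unfolding set_decode_def using div_less[of w "2 ^ n"] by (cases "2 ^ n \<le> w") auto

lemma set_decode_less: "n \<in> set_decode w \<Longrightarrow> n < w"
  using set_decode_le[of n w] less_exp[of n] by linarith

text \<open>Quantification over subsets of an initial segment is bounded quantification over their codes. This
  is what turns second-order graph properties into bounded arithmetical formulas.\<close>

lemma ex_set_decode:
  "(\<exists>w<2 ^ B. P (set_decode w)) \<longleftrightarrow> (\<exists>V\<subseteq>{..<B}. P V)"
proof
  assume "\<exists>w<2 ^ B. P (set_decode w)"
  then obtain w where w: "w < 2 ^ B" "P (set_decode w)" by blast
  have "set_decode w \<subseteq> {..<B}"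
  proof
    fix n assume "n \<in> set_decode w"
    then have "(2::nat) ^ n < 2 ^ B" using w(1) set_decode_le by (meson le_less_trans)
    then show "n \<in> {..<B}" by simp
  qed
  then show "\<exists>V\<subseteq>{..<B}. P V" using w(2) by blast
next
  assume "\<exists>V\<subseteq>{..<B}. P V"
  then obtain V where V: "V \<subseteq> {..<B}" "P V" by blast
  have "set_encode V \<le> (\<Sum>i<B. 2 ^ i)"
    unfolding set_encode_def using V(1) by (intro sum_mono2) auto
  also have "\<dots> < 2 ^ B"
    by (simp add: sum_power2[of B, unfolded atLeast0LessThan])
  finally show "\<exists>w<2 ^ B. P (set_decode w)"
    using V finite_subset[OF V(1)] by (intro exI[of _ "set_encode V"]) auto
qed

lemma all_set_decode:
  "(\<forall>w<2 ^ B. P (set_decode w)) \<longleftrightarrow> (\<forall>V\<subseteq>{..<B}. P V)"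
  using ex_set_decode[of B "\<lambda>V. \<not> P V"] by blast

text \<open>Graphs enter recursive predicates through a numerical code \<open>c\<close>, and the computable bound \<open>B\<close> on
  their vertices makes quantifiers over vertices and sets of vertices bounded.\<close>

definition decidable_rel :: "(nat \<Rightarrow> nat) \<Rightarrow> (nat \<Rightarrow> (nat \<times> nat) set) \<Rightarrow> bool" where
  "decidable_rel B R \<longleftrightarrow> computable 1 (\<lambda>xs. B (hd xs)) \<and> (\<forall>c. R c \<subseteq> {..<B c} \<times> {..<B c}) \<and>
    decidable 3 (\<lambda>xs. (hd xs, hd (tl xs)) \<in> R (hd (tl (tl xs))))"

lemma decidable_relD:
  assumes "decidable_rel B R"
  shows "computable n h \<Longrightarrow> computable n (\<lambda>xs. B (h xs))"
    and "computable n f \<Longrightarrow> computable n g \<Longrightarrow> computable n h \<Longrightarrow>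
      decidable n (\<lambda>xs. (f xs, g xs) \<in> R (h xs))"
    and "(a, b) \<in> R c \<Longrightarrow> a < B c" and "(a, b) \<in> R c \<Longrightarrow> b < B c"
  using assms computable_comp1[of B n h]
    computable_comp3[of "\<lambda>a b c. of_bool ((a, b) \<in> R c)" n f g h]
  unfolding decidable_rel_def decidable_def by (simp_all, blast+)

text \<open>A vertex is reachable from \<open>a\<close> iff it lies in every set that contains \<open>a\<close> and is closed under
  edges. Quantifying over closed sets needs neither codes of paths nor a bound on their length.\<close>

lemma decidable_rtrancl:
  assumes R: "decidable_rel B R" and fgh: "computable n f" "computable n g" "computable n h"
  shows "decidable n (\<lambda>xs. (f xs, g xs) \<in> (R (h xs))\<^sup>*)"
proof -
  have "(a, b) \<in> (R c)\<^sup>* \<longleftrightarrow> a = b \<or> (a < B c \<and> (\<forall>w < 2 ^ B c. a \<in> set_decode w \<and>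
      (\<forall>p<B c. \<forall>q<B c. p \<in> set_decode w \<and> (p, q) \<in> R c \<longrightarrow> q \<in> set_decode w) \<longrightarrow> b \<in> set_decode w))"
    (is "_ \<longleftrightarrow> ?rhs") for a b c
  proof -
    have step: "(\<forall>p<B c. \<forall>q<B c. p \<in> W \<and> (p, q) \<in> R c \<longrightarrow> q \<in> W) \<longleftrightarrow> R c `` W \<subseteq> W" for W
      using decidable_relD(3,4)[OF R] by blast
    have "?rhs \<longleftrightarrow> a = b \<or> (a < B c \<and> (\<forall>W\<subseteq>{..<B c}. a \<in> W \<and> R c `` W \<subseteq> W \<longrightarrow> b \<in> W))"
      unfolding step all_set_decode[of "B c" "\<lambda>W. a \<in> W \<and> R c `` W \<subseteq> W \<longrightarrow> b \<in> W"] ..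
    also have "\<dots> \<longleftrightarrow> (a, b) \<in> (R c)\<^sup>*"
    proof
      assume *: "a = b \<or> (a < B c \<and> (\<forall>W\<subseteq>{..<B c}. a \<in> W \<and> R c `` W \<subseteq> W \<longrightarrow> b \<in> W))"
      show "(a, b) \<in> (R c)\<^sup>*"
      proof (cases "a = b")
        case False
        let ?W = "(R c)\<^sup>* `` {a}"
        have "?W \<subseteq> {..<B c}"
        proof
          fix x assume "x \<in> ?W"
          then have "x = a \<or> (\<exists>y. (y, x) \<in> R c)" by (blast elim: rtranclE)
          then show "x \<in> {..<B c}" using * False decidable_relD(4)[OF R] by blast
        qed
        moreover have "R c `` ?W \<subseteq> ?W" by (auto intro: rtrancl_into_rtrancl)
        ultimately have "b \<in> ?W" using * False by blast
        then show ?thesis by simp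
      qed simp
    next
      assume ab: "(a, b) \<in> (R c)\<^sup>*"
      have "b \<in> W" if "a \<in> W" "R c `` W \<subseteq> W" for W
        using ab that by (induction rule: rtrancl_induct) auto
      moreover have "a = b \<or> a < B c"
        using ab decidable_relD(3)[OF R] by (blast elim: converse_rtranclE)
      ultimately show "a = b \<or> (a < B c \<and> (\<forall>W\<subseteq>{..<B c}. a \<in> W \<and> R c `` W \<subseteq> W \<longrightarrow> b \<in> W))"
        by blast
    qed
    finally show ?thesis by simp
  qed
  then show ?thesis
    by (simp only:) (intro decidable_intros computable_intros decidable_set_decode decidable_relD(1,2)[OF R] fgh computable_tl)
qed

lemma decidable_strongly_connected:
  assumes R: "decidable_rel B R" and f: "computable n f" and g: "computable n g"
  shows "decidable n (\<lambda>xs. strongly_connected (R (f xs)) (set_decode (g xs)))"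
proof -
  \<comment> \<open>The subgraph induced by a set of vertices, coded by the pair of the graph code and the set code.\<close>
  define S where "S d = R (fst (prod_decode d)) \<inter>
    set_decode (snd (prod_decode d)) \<times> set_decode (snd (prod_decode d))" for d
  have S: "decidable_rel (\<lambda>d. B (fst (prod_decode d))) S"
    unfolding decidable_rel_def
  proof (intro conjI allI)
    show "computable 1 (\<lambda>xs. B (fst (prod_decode (hd xs))))"
      unfolding One_nat_def by (intro decidable_relD(1,2)[OF R] computable_fst_decode computable_hd)
    show "S d \<subseteq> {..<B (fst (prod_decode d))} \<times> {..<B (fst (prod_decode d))}" for d
      using decidable_relD(3,4)[OF R] by (auto simp: S_def)
    show "decidable 3 (\<lambda>xs. (hd xs, hd (tl xs)) \<in> S (hd (tl (tl xs))))"
      unfolding S_def Int_iff mem_Sigma_iff numeral_3_eq_3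
      by (intro decidable_intros decidable_relD(1,2)[OF R] decidable_set_decode computable_fst_decode
          computable_snd_decode computable_hd computable_tl)
  qed
  have trancl: "(a, b) \<in> (S d)\<^sup>+ \<longleftrightarrow> (\<exists>c<B (fst (prod_decode d)). (a, c) \<in> S d \<and> (c, b) \<in> (S d)\<^sup>*)"
    for a b d
    using decidable_relD(4)[OF S] by (meson tranclD rtrancl_into_trancl2)
  have S_code: "R c \<inter> set_decode w \<times> set_decode w = S (prod_encode (c, w))" for c w
    by (simp add: S_def)
  have nonempty: "set_decode w \<noteq> {} \<longleftrightarrow> (\<exists>a<w. a \<in> set_decode w)" for w
    using set_decode_less by blast
  have ball: "(\<forall>a\<in>set_decode w. Q a) \<longleftrightarrow> (\<forall>a<w. a \<in> set_decode w \<longrightarrow> Q a)" for w Q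
    using set_decode_less by blast
  show ?thesis
    unfolding strongly_connected_def S_code trancl nonempty unfolding ball
    by (intro decidable_intros computable_intros decidable_set_decode decidable_relD(1,2)[OF S]
      decidable_rtrancl[OF S] computable_prod_encode computable_fst_decode computable_snd_decode f g computable_tl)
qed

section \<open>Sofic shifts are decidable\<close>

text \<open>For finite \<open>E\<close>, the sofic shift presented by the labelled graph.\<close>

definition path_labels :: "(nat \<times> 'a \<times> nat) set \<Rightarrow> (int \<Rightarrow> 'a) set" where
  "path_labels E = {x. \<exists>g. \<forall>i. (g i, x i, g (i + 1)) \<in> E}"

text \<open>Vertices of the product of two labelled graphs are coded as numbers, so that strong connectedness
  in the product is covered by the decidability results for relations on \<open>\<nat>\<close>.\<close>

definition product_edges :: "(nat \<times> 'a \<times> nat) set \<Rightarrow> (nat \<times> 'a \<times> nat) set \<Rightarrow> (nat \<times> nat) set" where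
  "product_edges E T = {(v, w). \<exists>a. (fst (prod_decode v), a, fst (prod_decode w)) \<in> E \<and>
    (snd (prod_decode v), a, snd (prod_decode w)) \<in> T}"

lemma finite_product_edges:
  assumes "finite E" "finite T"
  shows "finite (product_edges E T)"
proof -
  have "product_edges E T \<subseteq>
      (\<lambda>((p, a, q), (r, b, s)). (prod_encode (p, r), prod_encode (q, s))) ` (E \<times> T)"
    (is "_ \<subseteq> ?f ` _")
  proof
    fix e assume "e \<in> product_edges E T"
    then obtain v w a where "e = (v, w)" and E: "(fst (prod_decode v), a, fst (prod_decode w)) \<in> E"
      and T: "(snd (prod_decode v), a, snd (prod_decode w)) \<in> T"
      by (auto simp: product_edges_def)
    then have "e = ?f ((fst (prod_decode v), a, fst (prod_decode w)), (snd (prod_decode v), a, snd (prod_decode w)))"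
      by simp
    then show "e \<in> ?f ` (E \<times> T)" using E T by blast
  qed
  then show ?thesis using assms finite_subset by blast
qed

text \<open>By the pigeonhole principle: if \<open>s (h i)\<close> is \<open>q\<close> infinitely often, then so is one of the finitely
  many values of \<open>h\<close> that \<open>s\<close> maps to \<open>q\<close>.\<close>

lemma image_infinitely_often:
  assumes "finite (range h)"
  shows "s ` {v. infinite {i. h i = v}} = {q. infinite {i. s (h i) = q}}"
proof (intro equalityI subsetI)
  fix q assume "q \<in> s ` {v. infinite {i. h i = v}}"
  then obtain v where "q = s v" "infinite {i. h i = v}" by blast
  moreover have "{i. h i = v} \<subseteq> {i. s (h i) = s v}" by auto
  ultimately show "q \<in> {q. infinite {i. s (h i) = q}}" using infinite_super by blast
next
  fix q assume q: "q \<in> {q. infinite {i. s (h i) = q}}"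
  have "{i. s (h i) = q} = (\<Union>v\<in>{v \<in> range h. s v = q}. {i. h i = v})" by auto
  then have "infinite (\<Union>v\<in>{v \<in> range h. s v = q}. {i. h i = v})" using q by simp
  then obtain v where "s v = q" "infinite {i. h i = v}"
    using assms by auto
  then show "q \<in> s ` {v. infinite {i. h i = v}}" by blast
qed

text \<open>A point of the sofic shift together with an accepting run is a bi-infinite path in the product
  graph; the states visited infinitely often are the second components of the vertices visited
  infinitely often.\<close>

lemma path_labels_Int_muller_language_iff:
  fixes A :: "'a::finite muller"
  assumes E: "finite E" and A: "muller_automaton A"
  shows "path_labels E \<inter> muller_language A \<noteq> {} \<longleftrightarrow>
    (\<exists>V1 V2. strongly_connected (product_edges E (transitions A)) V1 \<and>
      strongly_connected (product_edges E (transitions A)) V2 \<and>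
      (\<exists>v\<in>V1. \<exists>w\<in>V2. (v, w) \<in> (product_edges E (transitions A))\<^sup>*) \<and>
      (\<lambda>v. snd (prod_decode v)) ` (V1 \<union> V2) \<in> acceptance A)" (is "_ \<longleftrightarrow> ?rhs")
proof -
  let ?R = "product_edges E (transitions A)"
  let ?s = "\<lambda>v. snd (prod_decode v)"
  have fin: "finite ?R" using finite_product_edges[OF E finite_muller_automaton(2)[OF A]] .
  have "path_labels E \<inter> muller_language A \<noteq> {} \<longleftrightarrow>
    (\<exists>h :: int \<Rightarrow> nat. (\<forall>i. (h i, h (i + 1)) \<in> ?R) \<and> ?s ` {v. infinite {i. h i = v}} \<in> acceptance A)"
  proof
    assume "path_labels E \<inter> muller_language A \<noteq> {}"
    then obtain x where "x \<in> path_labels E" "x \<in> muller_language A" by blast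
    then obtain g r where g: "\<And>i. (g i, x i, g (i + 1)) \<in> E"
      and r: "\<And>i. (r i, x i, r (i + 1)) \<in> transitions A"
      and acc: "{q. infinite {i. r i = q}} \<in> acceptance A"
      unfolding path_labels_def muller_language_def run_def mem_Collect_eq by (elim exE conjE) blast
    define h where "h i = prod_encode (g i, r i)" for i
    have h: "(h i, h (i + 1)) \<in> ?R" for i
      using g r by (auto simp: product_edges_def h_def)
    have "range h \<subseteq> fst ` ?R" using h by force
    then have "finite (range h)" using fin finite_subset by blast
    then have "?s ` {v. infinite {i. h i = v}} = {q. infinite {i. ?s (h i) = q}}"
      by (rule image_infinitely_often)
    then show "\<exists>h :: int \<Rightarrow> nat. (\<forall>i. (h i, h (i + 1)) \<in> ?R) \<and> ?s ` {v. infinite {i. h i = v}} \<in> acceptance A"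
      using h acc by (intro exI[of _ h]) (simp add: h_def)
  next
    assume "\<exists>h :: int \<Rightarrow> nat. (\<forall>i. (h i, h (i + 1)) \<in> ?R) \<and> ?s ` {v. infinite {i. h i = v}} \<in> acceptance A"
    then obtain h :: "int \<Rightarrow> nat" where h: "\<And>i. (h i, h (i + 1)) \<in> ?R"
      and acc: "?s ` {v. infinite {i. h i = v}} \<in> acceptance A" by blast
    have "\<forall>i. \<exists>a. (fst (prod_decode (h i)), a, fst (prod_decode (h (i + 1)))) \<in> E \<and>
        (?s (h i), a, ?s (h (i + 1))) \<in> transitions A"
      using h unfolding product_edges_def by blast
    then obtain x where x: "\<And>i. (fst (prod_decode (h i)), x i, fst (prod_decode (h (i + 1)))) \<in> E"
      "\<And>i. (?s (h i), x i, ?s (h (i + 1))) \<in> transitions A"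
      by metis
    have "range h \<subseteq> fst ` ?R" using h by force
    then have "finite (range h)" using fin finite_subset by blast
    then have "?s ` {v. infinite {i. h i = v}} = {q. infinite {i. ?s (h i) = q}}"
      by (rule image_infinitely_often)
    then have "x \<in> muller_language A"
      unfolding muller_language_def run_def using x(2) acc by (auto intro!: exI[of _ "\<lambda>i. ?s (h i)"])
    moreover have "x \<in> path_labels E"
      unfolding path_labels_def using x(1) by (auto intro!: exI[of _ "\<lambda>i. fst (prod_decode (h i))"])
    ultimately show "path_labels E \<inter> muller_language A \<noteq> {}" by blast
  qed
  also have "\<dots> \<longleftrightarrow> (\<exists>V. (\<exists>h :: int \<Rightarrow> nat. (\<forall>i. (h i, h (i + 1)) \<in> ?R) \<and> {v. infinite {i. h i = v}} = V) \<and>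
      ?s ` V \<in> acceptance A)"
    by blast
  also have "\<dots> \<longleftrightarrow> ?rhs"
    unfolding bi_infinite_path_iff[OF fin] by blast
  finally show ?thesis .
qed

lemma prod_encode_mono: "a \<le> c \<Longrightarrow> b \<le> d \<Longrightarrow> prod_encode (a, b) \<le> prod_encode (c, d)"
proof -
  assume "a \<le> c" "b \<le> d"
  have "mono triangle" by (intro incseq_SucI) simp
  then have "triangle (a + b) \<le> triangle (c + d)"
    using \<open>a \<le> c\<close> \<open>b \<le> d\<close> by (intro monoD[of triangle]) auto
  then show ?thesis using \<open>a \<le> c\<close> by (simp add: prod_encode_def)
qed

text \<open>The criterion for nonempty intersection is evaluated on codes: the product graph has vertices below
  a bound computed from the code of the automaton, and its two strongly connected sets range over the
  codes of subsets below that bound.\<close>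

lemma decidable_path_labels:
  assumes fE: "finite E"
  shows "decidable_subshift (path_labels E :: (int \<Rightarrow> 'a::finite) set)"
proof -
  \<comment> \<open>The code \<open>e\<close> of the graph and the bound \<open>L\<close> on the letter codes are constants of the algorithm.\<close>
  define e where "e = set_encode (transition_code ` E)"
  have dec_e: "set_decode e = transition_code ` E"
    using fE by (simp add: e_def)
  define L where "L = Suc (Max (range (to_nat :: 'a \<Rightarrow> nat)))"
  have L: "to_nat (a :: 'a) < L" for a
    by (simp add: L_def less_Suc_eq_le)
  \<comment> \<open>The parts of the automaton code that hold the transitions and the acceptance family.\<close>
  define tc where "tc c = fst (prod_decode (snd (prod_decode c)))" for c :: nat
  define ac where "ac c = snd (prod_decode (snd (prod_decode c)))" for c :: nat
  \<comment> \<open>A number in a coded set is smaller than the code, so \<open>e\<close> and \<open>c\<close> bound the two components of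
    the vertices that have edges.\<close>
  define B where "B c = Suc (prod_encode (e, c))" for c
  define R where "R c = {(v, w). \<exists>l<L.
    prod_encode (fst (prod_decode v), prod_encode (l, fst (prod_decode w))) \<in> set_decode e \<and>
    prod_encode (snd (prod_decode v), prod_encode (l, snd (prod_decode w))) \<in> set_decode (tc c)}" for c
  have tc_le: "tc c \<le> c" for c
    unfolding tc_def by (metis le_prod_encode_1 le_prod_encode_2 le_trans prod.collapse prod_decode_inverse)
  have code_less: "p < w" "q < w" if "prod_encode (p, prod_encode (l, q)) \<in> set_decode w" for p q l w
  proof -
    have "prod_encode (p, prod_encode (l, q)) < w" using that by (rule set_decode_less)
    then show "p < w" "q < w"
      using le_prod_encode_1[of p "prod_encode (l, q)"] le_prod_encode_2[of "prod_encode (l, q)" p]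
        le_prod_encode_2[of q l] by linarith+
  qed
  have R: "decidable_rel B R"
    unfolding decidable_rel_def
  proof (intro conjI allI subsetI)
    show "computable 1 (\<lambda>xs. B (hd xs))"
      unfolding B_def One_nat_def by (intro computable_intros computable_prod_encode)
    show "decidable 3 (\<lambda>xs. (hd xs, hd (tl xs)) \<in> R (hd (tl (tl xs))))"
      unfolding R_def tc_def mem_Collect_eq prod.case numeral_3_eq_3
      by (intro decidable_intros decidable_set_decode computable_prod_encode computable_fst_decode
          computable_snd_decode computable_hd computable_const computable_tl)
    fix c z assume "z \<in> R c"
    then obtain v w l where z: "z = (v, w)"
      and 1: "prod_encode (fst (prod_decode v), prod_encode (l, fst (prod_decode w))) \<in> set_decode e"
      and 2: "prod_encode (snd (prod_decode v), prod_encode (l, snd (prod_decode w))) \<in> set_decode (tc c)"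
      by (auto simp: R_def)
    have "u < B c" if "fst (prod_decode u) < e" "snd (prod_decode u) < tc c" for u
      using prod_encode_mono[of "fst (prod_decode u)" e "snd (prod_decode u)" c] that tc_le[of c]
      by (simp add: B_def)
    then show "z \<in> {..<B c} \<times> {..<B c}"
      using code_less[OF 1] code_less[OF 2] z by simp
  qed
  define accepts where "accepts c \<longleftrightarrow> (\<exists>v1<2 ^ B c. \<exists>v2<2 ^ B c.
     strongly_connected (R c) (set_decode v1) \<and> strongly_connected (R c) (set_decode v2) \<and>
     (\<exists>v<B c. \<exists>w<B c. v \<in> set_decode v1 \<and> w \<in> set_decode v2 \<and> (v, w) \<in> (R c)\<^sup>*) \<and>
     (\<exists>F<ac c. F \<in> set_decode (ac c) \<and>
       (\<forall>q<B c. q \<in> set_decode F \<longleftrightarrow>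
         (\<exists>v<B c. (v \<in> set_decode v1 \<or> v \<in> set_decode v2) \<and> snd (prod_decode v) = q))))" for c
  have "decidable 1 (\<lambda>xs. accepts (hd xs))"
    unfolding accepts_def ac_def One_nat_def
    by (intro decidable_intros decidable_set_decode computable_fst_decode computable_snd_decode
        decidable_strongly_connected[OF R] decidable_rtrancl[OF R] decidable_relD(1,2)[OF R]
        computable_intros computable_tl)
  then obtain p where p: "\<And>xs. length xs = 1 \<Longrightarrow> eval p xs (of_bool (accepts (hd xs)))"
    unfolding decidable_def computable_def by blast
  have "accepts (muller_code A) \<longleftrightarrow> path_labels E \<inter> muller_language A \<noteq> {}"
    if A: "muller_automaton A" for A :: "'a muller"
  proof -
    let ?c = "muller_code A"
    let ?P = "product_edges E (transitions A)"
    let ?s = "\<lambda>v. snd (prod_decode v)"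
    note finA = finite_muller_automaton[OF A]
    have dec_t: "set_decode (tc ?c) = transition_code ` transitions A"
      using finA by (simp add: tc_def muller_code_def)
    have ac: "ac ?c = set_encode (set_encode ` acceptance A)"
      by (simp add: ac_def muller_code_def)
    then have dec_a: "set_decode (ac ?c) = set_encode ` acceptance A"
      using finA by simp
    have ac_less: "ac ?c < B ?c"
      by (simp add: ac_def B_def) (metis le_imp_less_Suc le_prod_encode_2 le_trans prod.collapse prod_decode_inverse)
    have RP: "R ?c = ?P"
    proof -
      have mem: "prod_encode (p, prod_encode (l, q)) \<in> transition_code ` T \<longleftrightarrow>
          (\<exists>a. l = to_nat a \<and> (p, a, q) \<in> T)" for p l q and T :: "(nat \<times> 'a \<times> nat) set"
        by (force simp: transition_code_def image_iff)
      show ?thesis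
        unfolding R_def product_edges_def dec_e dec_t mem using L by auto
    qed
    have B: "V \<subseteq> {..<B ?c}" if "strongly_connected ?P V" for V
    proof
      fix v assume "v \<in> V"
      then have "(v, v) \<in> (?P \<inter> V \<times> V)\<^sup>+" using that unfolding strongly_connected_def by blast
      then obtain w where "(v, w) \<in> ?P" using tranclD by fastforce
      then show "v \<in> {..<B ?c}" using decidable_relD(3)[OF R, of v w ?c] RP by simp
    qed
    \<comment> \<open>Accepting sets and projections of vertices contain only numbers below the bound, so the bounded
      quantifiers over states amount to an equality of sets.\<close>
    have F: "(\<exists>F<ac ?c. F \<in> set_decode (ac ?c) \<and> (\<forall>q<B ?c. q \<in> set_decode F \<longleftrightarrow>
         (\<exists>v<B ?c. (v \<in> V1 \<or> v \<in> V2) \<and> ?s v = q))) \<longleftrightarrow> ?s ` (V1 \<union> V2) \<in> acceptance A"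
      (is "?l \<longleftrightarrow> _") if V: "V1 \<subseteq> {..<B ?c}" "V2 \<subseteq> {..<B ?c}" for V1 V2
    proof -
      have less: "q < B ?c" if "q \<in> F" "F \<in> acceptance A" for q F
      proof -
        have "set_encode F < ac ?c" using that(2) dec_a set_decode_less by blast
        moreover have "q < set_encode F" using that finA(4) set_decode_less by simp
        ultimately show ?thesis using ac_less by simp
      qed
      have s_less: "?s v < B ?c" if "v < B ?c" for v
        using that le_prod_encode_2[of "?s v" "fst (prod_decode v)"] by simp
      have img: "(\<exists>v<B ?c. (v \<in> V1 \<or> v \<in> V2) \<and> ?s v = q) \<longleftrightarrow> q \<in> ?s ` (V1 \<union> V2)" for q
        using V by auto
      have "?l \<longleftrightarrow> (\<exists>F\<in>acceptance A. \<forall>q<B ?c. q \<in> F \<longleftrightarrow> q \<in> ?s ` (V1 \<union> V2))"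
      proof -
        have "?l \<longleftrightarrow> (\<exists>F\<in>set_decode (ac ?c). \<forall>q<B ?c. q \<in> set_decode F \<longleftrightarrow>
           (\<exists>v<B ?c. (v \<in> V1 \<or> v \<in> V2) \<and> ?s v = q))"
          using set_decode_less by blast
        also have "\<dots> \<longleftrightarrow> (\<exists>F\<in>acceptance A. \<forall>q<B ?c. q \<in> F \<longleftrightarrow>
           (\<exists>v<B ?c. (v \<in> V1 \<or> v \<in> V2) \<and> ?s v = q))"
          unfolding dec_a using finA(4) by (simp add: Bex_def)
        finally show ?thesis unfolding img .
      qed
      also have "\<dots> \<longleftrightarrow> (\<exists>F\<in>acceptance A. F = ?s ` (V1 \<union> V2))"
      proof (intro bex_cong refl iffI)
        fix F assume F: "F \<in> acceptance A" "\<forall>q<B ?c. q \<in> F \<longleftrightarrow> q \<in> ?s ` (V1 \<union> V2)"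
        have "?s ` (V1 \<union> V2) \<subseteq> {..<B ?c}" using V s_less by auto
        then show "F = ?s ` (V1 \<union> V2)"
          using F less[OF _ F(1)] by (metis (no_types, lifting) lessThan_iff subset_eq subset_antisym)
      qed simp
      finally show ?thesis by simp
    qed
    have reach: "(\<exists>v<B ?c. \<exists>w<B ?c. v \<in> V1 \<and> w \<in> V2 \<and> (v, w) \<in> ?P\<^sup>*) \<longleftrightarrow>
        (\<exists>v\<in>V1. \<exists>w\<in>V2. (v, w) \<in> ?P\<^sup>*)" if "V1 \<subseteq> {..<B ?c}" "V2 \<subseteq> {..<B ?c}" for V1 V2
      using that by blast
    define Q where "Q V1 V2 \<longleftrightarrow> strongly_connected ?P V1 \<and> strongly_connected ?P V2 \<and>
     (\<exists>v<B ?c. \<exists>w<B ?c. v \<in> V1 \<and> w \<in> V2 \<and> (v, w) \<in> ?P\<^sup>*) \<and>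
     (\<exists>F<ac ?c. F \<in> set_decode (ac ?c) \<and>
       (\<forall>q<B ?c. q \<in> set_decode F \<longleftrightarrow> (\<exists>v<B ?c. (v \<in> V1 \<or> v \<in> V2) \<and> ?s v = q)))" for V1 V2
    have "accepts ?c \<longleftrightarrow> (\<exists>v1<2 ^ B ?c. \<exists>v2<2 ^ B ?c. Q (set_decode v1) (set_decode v2))"
      unfolding accepts_def RP Q_def ..
    also have "\<dots> \<longleftrightarrow> (\<exists>V1\<subseteq>{..<B ?c}. \<exists>V2\<subseteq>{..<B ?c}. Q V1 V2)"
      unfolding ex_set_decode[of _ "Q _"]
        ex_set_decode[of _ "\<lambda>V1. \<exists>V2\<subseteq>{..<B ?c}. Q V1 V2"] ..
    also have "\<dots> \<longleftrightarrow> (\<exists>V1 V2. strongly_connected ?P V1 \<and> strongly_connected ?P V2 \<and>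
      (\<exists>v\<in>V1. \<exists>w\<in>V2. (v, w) \<in> ?P\<^sup>*) \<and> ?s ` (V1 \<union> V2) \<in> acceptance A)" (is "_ \<longleftrightarrow> ?rhs")
    proof
      assume "\<exists>V1\<subseteq>{..<B ?c}. \<exists>V2\<subseteq>{..<B ?c}. Q V1 V2"
      then obtain V1 V2 where V: "V1\<subseteq>{..<B ?c}" "V2\<subseteq>{..<B ?c}" and "Q V1 V2" by blast
      then show ?rhs unfolding Q_def F[OF V] reach[OF V] by blast
    next
      assume ?rhs
      then obtain V1 V2 where *: "strongly_connected ?P V1" "strongly_connected ?P V2"
        "\<exists>v\<in>V1. \<exists>w\<in>V2. (v, w) \<in> ?P\<^sup>*" "?s ` (V1 \<union> V2) \<in> acceptance A" by blast
      then have "Q V1 V2" unfolding Q_def F[OF B B, OF *(1,2)] reach[OF B B, OF *(1,2)] by blast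
      then show "\<exists>V1\<subseteq>{..<B ?c}. \<exists>V2\<subseteq>{..<B ?c}. Q V1 V2" using B *(1,2) by blast
    qed
    also have "\<dots> \<longleftrightarrow> path_labels E \<inter> muller_language A \<noteq> {}"
      using path_labels_Int_muller_language_iff[OF fE A] by blast
    finally show ?thesis .
  qed
  then have "eval p [muller_code A] (if path_labels E \<inter> muller_language A \<noteq> {} then 1 else 0)"
    if "muller_automaton A" for A :: "'a muller"
    using p[of "[muller_code A]"] that by (simp add: of_bool_def)
  then show ?thesis unfolding decidable_subshift_def by blast
qed

section \<open>The subshift of a two-sided point as a sofic shift\<close>

text \<open>A graph with one vertex for each position of \<open>u @ v @ u\<close>: a cycle reading \<open>u\<close>, then a segment
  reading \<open>v\<close>, then a second cycle reading \<open>u\<close>. Each edge carries the letter of its source.\<close>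

definition lasso_edges :: "'a list \<Rightarrow> 'a list \<Rightarrow> (nat \<times> 'a \<times> nat) set" where
  "lasso_edges u v = (let n = length u; m = length v; N = n + m + n in
    {(k, (u @ v @ u) ! k, k') | k k'. k < N \<and>
      (k' = Suc k \<and> k' < N \<or> k = n - 1 \<and> k' = 0 \<or> k = N - 1 \<and> k' = n + m)})"

lemma finite_lasso_edges: "finite (lasso_edges u v)"
proof -
  let ?N = "length u + length v + length u"
  have "lasso_edges u v \<subseteq> (\<lambda>(k, k'). (k, (u @ v @ u) ! k, k')) ` ({..<?N} \<times> {..?N})"
    unfolding lasso_edges_def Let_def by auto
  then show ?thesis by (rule finite_subset) simp
qed

lemma cyclic_succ:
  fixes i n :: int assumes "n > 0"
  shows "(i + 1) mod n = (if i mod n = n - 1 then 0 else i mod n + 1)"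
proof -
  have "0 \<le> i mod n" "i mod n < n" using assms by auto
  moreover have "(i + 1) mod n = (i mod n + 1) mod n" by (simp add: mod_add_left_eq)
  ultimately show ?thesis by auto
qed

lemma cyclic_counter:
  fixes c :: "int \<Rightarrow> nat"
  assumes n: "n > 0" and less: "\<And>i. c i < n"
    and succ: "\<And>i. c (i + 1) = (if c i = n - 1 then 0 else Suc (c i))"
  shows "int (c i) = (i + int (c 0)) mod int n"
proof (induction i rule: int_induct[where k = 0])
  case base
  then show ?case using less[of 0] by simp
next
  case (step1 i)
  then show ?case
    using succ[of i] n cyclic_succ[of "int n" "i + int (c 0)"] by (auto simp: algebra_simps of_nat_diff split: if_splits)
next
  case (step2 i)
  have "int (c i) = (if int (c (i - 1)) = int n - 1 then 0 else int (c (i - 1)) + 1)"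
    using succ[of "i - 1"] n less[of "i - 1"] by auto
  moreover have "int (c i) = (if (i - 1 + int (c 0)) mod int n = int n - 1 then 0
      else (i - 1 + int (c 0)) mod int n + 1)"
    using step2.IH cyclic_succ[of "int n" "i - 1 + int (c 0)"] n by (simp add: algebra_simps)
  moreover have "0 \<le> (i - 1 + int (c 0)) mod int n" using n by simp
  moreover have "(i - 1 + int (c 0)) mod int n < int n" using n by simp
  ultimately show ?case
    using less[of "i - 1"] by (smt (verit) of_nat_0_le_iff)
qed

lemma orbitI: "(\<And>i. x i = y (i + k)) \<Longrightarrow> x \<in> orbit y"
  by (auto simp: orbit_def fun_eq_iff)

lemma orbit_subset_path_labels:
  assumes "x \<in> path_labels E"
  shows "orbit x \<subseteq> path_labels E"
proof
  fix y assume "y \<in> orbit x"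
  then obtain k where y: "y = (\<lambda>i. x (i + k))" unfolding orbit_def by blast
  obtain g where "\<And>i. (g i, x i, g (i + 1)) \<in> E" using assms unfolding path_labels_def by blast
  from this[of "_ + k"] have "\<forall>i. (g (i + k), y i, g (i + 1 + k)) \<in> E"
    unfolding y by (simp add: add_ac)
  then show "y \<in> path_labels E"
    unfolding path_labels_def by (auto intro!: exI[of _ "\<lambda>i. g (i + k)"])
qed

text \<open>A bi-infinite path either stays in one of the two cycles forever and reads the periodic point, or
  crosses exactly once from vertex \<open>n - 1\<close> to vertex \<open>n\<close>. The crossing determines the rest of the path:
  the only vertex with two successors is \<open>n - 1\<close>, which cannot be reached after the crossing, and the only
  vertex with two predecessors is \<open>n + m\<close>, which is not visited before it.\<close>

lemma path_labels_lasso: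
  assumes u: "u \<noteq> []"
  shows "path_labels (lasso_edges u v) = orbit (two_sided_point u v) \<union> orbit (two_sided_point u [])"
proof
  define n where "n = length u"
  define m where "m = length v"
  define w where "w = u @ v @ u"
  have n: "n > 0" using u by (simp add: n_def)
  have E: "(k, a, k') \<in> lasso_edges u v \<longleftrightarrow> a = w ! k \<and> k < n + m + n \<and>
      (k' = Suc k \<and> k' < n + m + n \<or> k = n - 1 \<and> k' = 0 \<or> k = n + m + n - 1 \<and> k' = n + m)" for k a k'
    unfolding lasso_edges_def Let_def n_def m_def w_def by auto
  \<comment> \<open>The path that crosses from the first cycle at time \<open>0\<close>.\<close>
  define G where "G i = (if i < 0 then nat (i mod int n) else if i < int m then n + nat i
    else n + m + nat ((i - int m) mod int n))" for i
  have md: "0 \<le> i mod int n" "i mod int n < int n" for i using n by auto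
  have mdn: "nat (i mod int n) < n" for i using md[of i] n by linarith
  have w_G: "w ! G i = two_sided_point u v i" for i
    using mdn by (auto simp: G_def w_def two_sided_point_def n_def m_def nth_append nat_less_iff)
  have w_p: "w ! nat (i mod int n) = two_sided_point u [] i"
    "w ! (n + m + nat (i mod int n)) = two_sided_point u [] i" for i
    using mdn[of i] by (auto simp: w_def two_sided_point_def n_def m_def nth_append)
  have G_succ: "G (i + 1) = (if i = -1 then n else if G i = n - 1 then 0
      else if G i = n + m + n - 1 then n + m else Suc (G i))" for i
  proof -
    consider "i < -1" | "i = -1" | "0 \<le> i" "i + 1 < int m" | "0 \<le> i" "i + 1 = int m" | "0 \<le> i" "i \<ge> int m"
      by linarith
    then show ?thesis
    proof cases
      case 1
      then show ?thesis using cyclic_succ[of "int n" i] n md[of i]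
        by (auto simp: G_def nat_eq_iff)
    next
      case 2
      then show ?thesis using n by (auto simp: G_def)
    next
      case 3
      then show ?thesis using n by (auto simp: G_def nat_eq_iff)
    next
      case 4
      then show ?thesis using n by (auto simp: G_def nat_eq_iff)
    next
      case 5
      then obtain d where i: "i = int m + d" "d \<ge> 0" using zle_iff_zadd by auto
      have "int m + d + 1 - int m = d + 1" by simp
      then show ?thesis using i cyclic_succ[of "int n" d] n md[of d]
        by (auto simp: G_def nat_eq_iff)
    qed
  qed
  have G_less: "G i < n + m + n" for i
    using mdn[of i] mdn[of "i - int m"] by (auto simp: G_def)
  have G_neg: "G (-1) = n - 1"
    using n by (simp add: G_def zmod_minus1)
  have "two_sided_point u v \<in> path_labels (lasso_edges u v)"
  proof -
    have "(G i, two_sided_point u v i, G (i + 1)) \<in> lasso_edges u v" for i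
      unfolding E w_G[symmetric] using G_succ[of i] G_less[of i] G_less[of "i + 1"] G_neg n by auto
    then show ?thesis unfolding path_labels_def by blast
  qed
  moreover have "two_sided_point u [] \<in> path_labels (lasso_edges u v)"
  proof -
    have "(nat (i mod int n), two_sided_point u [] i, nat ((i + 1) mod int n)) \<in> lasso_edges u v" for i
      unfolding E w_p[symmetric] using cyclic_succ[of "int n" i] n md[of i] by auto
    then show ?thesis unfolding path_labels_def by (auto intro!: exI[of _ "\<lambda>i. nat (i mod int n)"])
  qed
  ultimately show "orbit (two_sided_point u v) \<union> orbit (two_sided_point u []) \<subseteq> path_labels (lasso_edges u v)"
    using orbit_subset_path_labels by blast
  show "path_labels (lasso_edges u v) \<subseteq> orbit (two_sided_point u v) \<union> orbit (two_sided_point u [])"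
  proof
    fix x assume "x \<in> path_labels (lasso_edges u v)"
    then obtain g where g: "\<And>i. (g i, x i, g (i + 1)) \<in> lasso_edges u v"
      unfolding path_labels_def by blast
    note edge = g[unfolded E]
    have x: "x i = w ! g i" and g_less: "g i < n + m + n" for i using edge by auto
    consider (cross) k where "g (k - 1) < n" "g k \<ge> n" | (left) "\<And>i. g i < n" | (right) "\<And>i. g i \<ge> n + m"
    proof (cases "\<exists>i. g i < n")
      case True
      then obtain i where i: "g i < n" by blast
      show ?thesis
      proof (cases "\<exists>j. g j \<ge> n")
        case True
        then obtain j where j: "g j \<ge> n" by blast
        have up: "g (i' + int d) \<ge> n" if "g i' \<ge> n" for i' d
        proof (induction d)
          case (Suc d)
          then show ?case using edge[of "i' + int d"] n by (auto simp: algebra_simps)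
        qed (use that in simp)
        have "i \<le> j"
          using up[OF j, of "nat (i - j)"] i by (cases "i \<le> j") auto
        then have "g (i + int (nat (j - i))) \<ge> n" using j by simp
        then have "\<exists>d. g (i + int d) \<ge> n" by blast
        then obtain d where d: "g (i + int d) \<ge> n" "\<And>e. e < d \<Longrightarrow> g (i + int e) < n"
          unfolding exists_least_iff[of "\<lambda>d. g (i + int d) \<ge> n"] not_le by blast
        have "d > 0" using d(1) i by (cases d) auto
        then show ?thesis using d(1) d(2)[of "d - 1"] that(1)[of "i + int d"]
          by (simp add: of_nat_diff algebra_simps)
      next
        case False
        then show ?thesis using that(2) by (meson not_le)
      qed
    next
      case False
      have "g i \<noteq> n + j" if "j < m" for i j
        using that
      proof (induction j arbitrary: i)
        case 0
        have "g (i - 1) \<ge> n" using False by (meson not_le)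
        then show ?case using edge[of "i - 1"] n 0 by auto
      next
        case (Suc j)
        then show ?case using edge[of "i - 1"] n by auto
      qed
      then have "g i \<ge> n + m" for i
        using False by (metis le_add_diff_inverse nat_add_left_cancel_less not_le)
      then show ?thesis using that(3) by blast
    qed
    then show "x \<in> orbit (two_sided_point u v) \<union> orbit (two_sided_point u [])"
    proof cases
      case left
      have "int (g i) = (i + int (g 0)) mod int n" for i
      proof (rule cyclic_counter[OF n left])
        show "g (i + 1) = (if g i = n - 1 then 0 else Suc (g i))" for i
          using edge[of i] left[of i] left[of "i + 1"] n by auto
      qed
      then have "x i = two_sided_point u [] (i + int (g 0))" for i
        unfolding x w_p(1)[symmetric] by (metis nat_int)
      then show ?thesis by (blast intro: orbitI)
    next
      case right
      define c where "c i = g i - (n + m)" for i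
      have g_c: "g i = n + m + c i" for i using right by (simp add: c_def)
      have "int (c i) = (i + int (c 0)) mod int n" for i
      proof (rule cyclic_counter[OF n])
        show "c i < n" for i using g_less[of i] g_c[of i] by simp
        show "c (i + 1) = (if c i = n - 1 then 0 else Suc (c i))" for i
          using edge[of i] g_c[of i] g_c[of "i + 1"] g_less[of "i + 1"] n by auto
      qed
      then have "x i = two_sided_point u [] (i + int (c 0))" for i
        unfolding x w_p(2)[symmetric] g_c by (metis nat_int)
      then show ?thesis by (blast intro: orbitI)
    next
      case cross
      have gk: "g (k - 1) = n - 1" "g k = n" using cross edge[of "k - 1"] n by auto
      have "g (k + int i) = G (int i)" for i
      proof (induction i)
        case 0
        then show ?case using G_succ[of "-1"] gk by simp
      next
        case (Suc i)
        have "G (int i) \<ge> n" by (simp add: G_def)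
        then show ?case
          using edge[of "k + int i"] G_succ[of "int i"] Suc n g_less[of "k + int i"]
          by (auto simp: algebra_simps)
      qed
      moreover have "g (k - 1 - int i) = G (- 1 - int i)" for i
      proof (induction i)
        case 0
        then show ?case using G_neg gk by simp
      next
        case (Suc i)
        have "G (-1 - int i) < n" "G (- 1 - int (Suc i)) < n" using mdn by (simp_all add: G_def)
        then show ?case
          using edge[of "k - 1 - int (Suc i)"] G_succ[of "- 1 - int (Suc i)"] Suc n
          by (auto simp: algebra_simps split: if_splits)
      qed
      ultimately have "g (k + i) = G i" for i
      proof (cases "i \<ge> 0")
        case True
        then show ?thesis using \<open>\<And>i. g (k + int i) = G (int i)\<close>[of "nat i"] by simp
      next
        case False
        then show ?thesis
          using \<open>\<And>i. g (k - 1 - int i) = G (- 1 - int i)\<close>[of "nat (- 1 - i)"] by simp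
      qed
      from this[of "_ - k"] have "x i = two_sided_point u v (i + (- k))" for i
        unfolding x by (simp add: w_G)
      then show ?thesis by (blast intro: orbitI)
    qed
  qed
qed

lemma decidable_subshift_empty: "decidable_subshift {}"
  unfolding decidable_subshift_def using eval.zero by auto

theorem proposition8:
  fixes X :: "(int \<Rightarrow> 'a::finite) set"
  assumes "subshift X" and "countable X" and "num_subshifts X \<le> 3"
  shows "(X \<noteq> {} \<longrightarrow> (\<exists>u v. u \<noteq> [] \<and> X = orbit_closure (two_sided_point u v)))
    \<and> decidable_subshift X"
proof (cases "X = {}")
  case True
  then show ?thesis using decidable_subshift_empty by simp
next
  case False
  obtain u v where uv: "u \<noteq> []" "X = orbit_closure (two_sided_point u v)"
    "X = orbit (two_sided_point u v) \<union> orbit (two_sided_point u [])"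
    using countable_subshift_two_sided_point[OF assms False] .
  have "X = path_labels (lasso_edges u v)"
    using path_labels_lasso[OF uv(1), of v] uv(3) by simp
  then have "decidable_subshift X"
    using decidable_path_labels[OF finite_lasso_edges, of u v] by simp
  then show ?thesis using uv(1,2) by blast
qed

end
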